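(* Let $A$ be a unital C*-algebra and $A_0$ the real Banach space of its Hermitian elements. If $g:\mathbb{R}\to\mathbb{C}$ is $\mathcal{C}^\infty$, then the map $g_*:A_0\to A$, $x\mapsto g(x)$, belongs to $\mathcal{BC}^\infty(A_0,A)$.
   Context: For Hermitian $x$, $g(x)$ is defined by the continuous functional calculus: $g(x)=\Phi_x(g|_{\mathrm{Spec}\,x})$ where $\Phi_x:\mathcal{C}(\mathrm{Spec}\,x)\to A$ is the unique $*$-isomorphism onto the unital C*-algebra generated by $x$ sending the identity function to $x$. For real Banach spaces $E,F$ ($A$ regarded as a real Banach space), $\mathcal{BC}^\infty(E,F)$ is the space of functions $E\to F$ having continuous Fréchet derivatives of all orders on all of $E$, each bounded on every bounded subset of $E$. *)

theory Defs
  imports "HOL-Analysis.Analysis"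
begin

class cstar_algebra = real_normed_algebra_1 + banach +
  fixes scaleC :: "complex \<Rightarrow> 'a \<Rightarrow> 'a"
    and adj :: "'a \<Rightarrow> 'a"
  assumes scaleC_add_right: "scaleC c (x + y) = scaleC c x + scaleC c y"
    and scaleC_add_left: "scaleC (c + d) x = scaleC c x + scaleC d x"
    and scaleC_scaleC: "scaleC c (scaleC d x) = scaleC (c * d) x"
    and scaleC_one: "scaleC 1 x = x"
    and scaleR_scaleC: "scaleR r x = scaleC (complex_of_real r) x"
    and scaleC_mult_left: "scaleC c x * y = scaleC c (x * y)"
    and scaleC_mult_right: "x * scaleC c y = scaleC c (x * y)"
    and norm_scaleC: "norm (scaleC c x) = cmod c * norm x"
    and adj_adj: "adj (adj x) = x"
    and adj_add: "adj (x + y) = adj x + adj y"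
    and adj_mult: "adj (x * y) = adj y * adj x"
    and adj_scaleC: "adj (scaleC c x) = scaleC (cnj c) (adj x)"
    and cstar_identity: "norm (adj x * x) = norm x * norm x"

definition hermitian_elems :: "'a::cstar_algebra set" where
  "hermitian_elems = {x. adj x = x}"

definition spec :: "'a::cstar_algebra \<Rightarrow> complex set" where
  "spec x = {\<mu>. \<not> (\<exists>y. y * (x - scaleC \<mu> 1) = 1 \<and> (x - scaleC \<mu> 1) * y = 1)}"

text \<open>Unital C*-subalgebra generated by a Hermitian x: closure of polynomials in x
  (for Hermitian x, *-polynomials in x and 1 are just polynomials in x).\<close>
definition gen_cstar :: "'a::cstar_algebra \<Rightarrow> 'a set" where
  "gen_cstar x = closure {(\<Sum>i<n. scaleC (c i) (x ^ i)) | c n. True}"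

text \<open>Phi is (a representative of) the *-isomorphism C(Spec x) -> C*(x,1)
  sending the identity function to x. Elements of C(Spec x) are represented
  by functions complex => complex continuous on Spec x, identified when they
  agree on Spec x.\<close>
definition is_cfc :: "'a::cstar_algebra \<Rightarrow> ((complex \<Rightarrow> complex) \<Rightarrow> 'a) \<Rightarrow> bool" where
  "is_cfc x \<Phi> \<longleftrightarrow>
     (\<forall>f g. continuous_on (spec x) f \<longrightarrow> continuous_on (spec x) g \<longrightarrow>
        ((\<Phi> f = \<Phi> g) \<longleftrightarrow> (\<forall>z\<in>spec x. f z = g z))) \<and>
     (\<forall>f g. continuous_on (spec x) f \<longrightarrow> continuous_on (spec x) g \<longrightarrow>
        \<Phi> (\<lambda>z. f z + g z) = \<Phi> f + \<Phi> g \<and>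
        \<Phi> (\<lambda>z. f z * g z) = \<Phi> f * \<Phi> g) \<and>
     (\<forall>f c. continuous_on (spec x) f \<longrightarrow> \<Phi> (\<lambda>z. c * f z) = scaleC c (\<Phi> f)) \<and>
     (\<forall>f. continuous_on (spec x) f \<longrightarrow> \<Phi> (\<lambda>z. cnj (f z)) = adj (\<Phi> f)) \<and>
     \<Phi> (\<lambda>z. 1) = 1 \<and>
     \<Phi> (\<lambda>z. z) = x \<and>
     \<Phi> ` {f. continuous_on (spec x) f} = gen_cstar x"

text \<open>g(x) = Phi_x (g restricted to Spec x), for g : R -> C (Spec x is real for Hermitian x).\<close>
definition cfc :: "'a::cstar_algebra \<Rightarrow> (real \<Rightarrow> complex) \<Rightarrow> 'a" where
  "cfc x g = (SOME \<Phi>. is_cfc x \<Phi>) (\<lambda>z. g (Re z))"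

definition smooth_real_fun :: "(real \<Rightarrow> complex) \<Rightarrow> bool" where
  "smooth_real_fun g \<longleftrightarrow> (\<exists>G :: nat \<Rightarrow> real \<Rightarrow> complex. G 0 = g \<and>
      (\<forall>k t. (G k has_vector_derivative G (Suc k) t) (at t)))"

text \<open>BC^infinity(E,F) where E is a real normed space given as a subset S
  (a real linear subspace) of the ambient space. D k x is the k-th Frechet
  derivative at x, as a k-linear map on S (argument list of length k).\<close>
definition BC_infty :: "'a::real_normed_vector set \<Rightarrow> ('a \<Rightarrow> 'b::real_normed_vector) \<Rightarrow> bool" where
  "BC_infty S f \<longleftrightarrow> (\<exists>D :: nat \<Rightarrow> 'a \<Rightarrow> 'a list \<Rightarrow> 'b.
     (\<forall>x\<in>S. D 0 x [] = f x) \<and>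
     \<comment> \<open>each D k x is k-linear (over the reals) on S\<close>
     (\<forall>k. \<forall>x\<in>S. \<forall>hs. set hs \<subseteq> S \<longrightarrow> length hs = k \<longrightarrow>
        (\<forall>i<k. \<forall>a\<in>S. \<forall>b\<in>S. \<forall>r::real.
           D k x (hs[i := a + b]) = D k x (hs[i := a]) + D k x (hs[i := b]) \<and>
           D k x (hs[i := r *\<^sub>R a]) = r *\<^sub>R D k x (hs[i := a]))) \<and>
     \<comment> \<open>each D k x is bounded\<close>
     (\<forall>k. \<forall>x\<in>S. \<exists>C. \<forall>hs. set hs \<subseteq> S \<longrightarrow> length hs = k \<longrightarrow>
        norm (D k x hs) \<le> C * (\<Prod>h\<leftarrow>hs. norm h)) \<and>
     \<comment> \<open>D (k+1) x is the Frechet derivative of D k at x (in operator norm)\<close>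
     (\<forall>k. \<forall>x\<in>S. \<forall>\<epsilon>>0. \<exists>\<delta>>0. \<forall>y\<in>S. norm (y - x) < \<delta> \<longrightarrow>
        (\<forall>hs. set hs \<subseteq> S \<longrightarrow> length hs = k \<longrightarrow>
          norm (D k y hs - D k x hs - D (Suc k) x ((y - x) # hs))
            \<le> \<epsilon> * norm (y - x) * (\<Prod>h\<leftarrow>hs. norm h))) \<and>
     \<comment> \<open>each D k is continuous (in operator norm)\<close>
     (\<forall>k. \<forall>x\<in>S. \<forall>\<epsilon>>0. \<exists>\<delta>>0. \<forall>y\<in>S. norm (y - x) < \<delta> \<longrightarrow>
        (\<forall>hs. set hs \<subseteq> S \<longrightarrow> length hs = k \<longrightarrow>
          norm (D k y hs - D k x hs) \<le> \<epsilon> * (\<Prod>h\<leftarrow>hs. norm h))) \<and>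
     \<comment> \<open>each D k is bounded on bounded subsets of S\<close>
     (\<forall>k B. B \<subseteq> S \<longrightarrow> bounded B \<longrightarrow> (\<exists>C. \<forall>x\<in>B. \<forall>hs. set hs \<subseteq> S \<longrightarrow> length hs = k \<longrightarrow>
        norm (D k x hs) \<le> C * (\<Prod>h\<leftarrow>hs. norm h))))"

end

(* The k-th derivative of a polynomial p at x in directions h_1, ..., h_k is the coefficient of
   t_1 ... t_k in p(x + t_1 h_1 + ... + t_k h_k). On the ball of radius R of the Hermitian elements
   its norm is bounded by a seminorm max_{i <= N} sup_{[-R, R]} |p^(i)|, with N depending on k only:
   expand p in the Chebyshev polynomials V_n(t) = U_n(t / R). Their derivatives grow polynomially
   in n, since differentiating the three-term recurrence gives
     DV_n(x) h = (2/R) sum_{j < n} V_{n-1-j}(x) h V_j(x)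
   and the spectral theorem gives |V_n(x)| <= n + 1. The coefficients of p decay faster than any
   power of n, with bounds by the seminorms, because V_n is an eigenvector, for the eigenvalue
   (n + 1)^2, of the operator (t^2 - R^2) d^2/dt^2 + 3 t d/dt + 1. Finally g is the limit of
   polynomials, with all derivatives and locally uniformly, and the estimate lets the derivatives
   and the Taylor bound for polynomials pass to this limit. *)
theory Submission
  imports Defs "HOL-Computational_Algebra.Fundamental_Theorem_Algebra"
begin

text \<open>The obstacle is that a direction \<open>h\<close> need not commute with
  \<open>x\<close>. The derivative of x^n is a sum of terms x^i h x^j, so it is no function of
  \<open>x\<close>, and in general a bound on g' alone does not control it; further derivatives are
  spent on summability. Chebyshev polynomials of the second kind fit because their generating
  function \<Sum> s^n V_n(x) is the inverse of 1 - (2 s / R) x + s^2. Differentiating an inverse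
  puts \<open>h\<close> between two copies of it: this is the formula for DV_n. It contains only the
  values V_j(x), to which the spectral theorem applies. Every polynomial is a finite combination of
  the V_n, so no series in the algebra has to converge in the estimate. A second obstacle is that
  \<open>cfc\<close> selects its calculus by SOME: one calculus has to be constructed, and every
  calculus shown contractive, before \<open>cfc\<close> can be compared with polynomials. Both rest
  on the fact that a Hermitian element attains its norm on its spectrum. This is proved by averaging
  resolvents over roots of unity, without contour integrals.\<close>

section \<open>Inverses in monoids and Banach algebras\<close>

definition inverts :: "'a::monoid_mult \<Rightarrow> 'a \<Rightarrow> bool" where
  "inverts a b \<longleftrightarrow> a * b = 1 \<and> b * a = 1"

definition is_invertible :: "'a::monoid_mult \<Rightarrow> bool" where
  "is_invertible a \<longleftrightarrow> (\<exists>b. inverts a b)"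

lemma inverts_unique:
  assumes "a * b = 1" "c * a = 1"
  shows "b = (c :: 'a::monoid_mult)"
  by (metis assms mult.assoc mult_1_left mult_1_right)

lemma is_invertibleI: "a * b = 1 \<Longrightarrow> c * a = 1 \<Longrightarrow> is_invertible (a :: 'a::monoid_mult)"
  using inverts_unique unfolding is_invertible_def inverts_def by metis

lemma is_invertible_mult:
  fixes a b :: "'a::monoid_mult"
  assumes "is_invertible a" "is_invertible b"
  shows "is_invertible (a * b)"
proof -
  obtain c d where "inverts a c" "inverts b d"
    using assms by (auto simp: is_invertible_def)
  then have "(a * b) * (d * c) = 1" "(d * c) * (a * b) = 1"
    unfolding inverts_def by (metis mult.assoc mult_1_left)+
  then show ?thesis by (rule is_invertibleI)
qed

text \<open>An inverse \<open>c\<close> of the product gives the right inverse \<open>b * c\<close>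
  of \<open>a\<close> and, by commutation, the left inverse \<open>c * b\<close>. Spectral mapping
  uses this for commuting polynomials in one element.\<close>

lemma is_invertible_factor:
  fixes a b :: "'a::monoid_mult"
  assumes "a * b = b * a" "is_invertible (a * b)"
  shows "is_invertible a"
proof -
  obtain c where "(a * b) * c = 1" "c * (a * b) = 1"
    using assms(2) by (auto simp: is_invertible_def inverts_def)
  then have "a * (b * c) = 1" "(c * b) * a = 1"
    by (metis assms(1) mult.assoc)+
  then show ?thesis by (rule is_invertibleI)
qed

lemma neumann_inverse:
  fixes a :: "'a::{real_normed_algebra_1,banach}"
  assumes "norm a < 1"
  shows "\<exists>b. inverts (1 - a) b \<and> norm b \<le> 1 / (1 - norm a)"
proof -
  have s: "summable (\<lambda>n. a ^ n)"
    by (rule summable_norm_cancel, rule summable_comparison_test[of _ "\<lambda>n. norm a ^ n"])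
      (use assms norm_power_ineq[of a] in \<open>auto intro!: summable_geometric\<close>)
  define b where "b = (\<Sum>n. a ^ n)"
  have 1: "b = 1 + a * b"
    using suminf_split_head[OF s] suminf_mult[OF s, of a] by (simp add: b_def algebra_simps)
  have 2: "b = 1 + b * a"
    using suminf_split_head[OF s] suminf_mult2[OF s, of a]
    by (simp add: b_def algebra_simps power_commutes)
  have "norm b \<le> 1 + norm a * norm b"
    by (subst 1) (metis norm_mult_ineq norm_one norm_triangle_ineq add_left_mono order_trans)
  then have "norm b \<le> 1 / (1 - norm a)"
    using assms by (simp add: field_simps)
  moreover have "inverts (1 - a) b"
    using 1 2 unfolding inverts_def by (simp add: algebra_simps)
  ultimately show ?thesis by blast
qed

text \<open>The factorisation \<open>c = a * (1 - b * (a - c))\<close> reduces invertibility to the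
  Neumann series. The explicit bound is there for the continuity of inversion.\<close>

lemma perturb_inverse:
  fixes a b c :: "'a::{real_normed_algebra_1,banach}"
  assumes "inverts a b" "norm (c - a) * norm b < 1"
  shows "\<exists>d. inverts c d \<and> norm (d - b) \<le> norm b * norm b * norm (c - a) / (1 - norm (c - a) * norm b)"
proof -
  have ab: "a * b = 1" "b * a = 1" using assms(1) by (auto simp: inverts_def)
  have n: "norm (b * (a - c)) \<le> norm (c - a) * norm b"
    by (metis norm_mult_ineq norm_minus_commute mult.commute)
  then obtain e where e: "inverts (1 - b * (a - c)) e" 
    using neumann_inverse[of "b * (a - c)"] assms(2) by auto
  have c: "c = a * (1 - b * (a - c))"
    using ab by (simp add: algebra_simps flip: mult.assoc)
  have "is_invertible c"
    by (subst c, rule is_invertible_mult) (use e assms(1) in \<open>auto simp: is_invertible_def\<close>)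
  then obtain d where d: "c * d = 1" "d * c = 1" by (auto simp: is_invertible_def inverts_def)
  have diff: "d - b = b * (a - c) * d"
    using ab d by (simp add: algebra_simps)
  let ?q = "norm (c - a) * norm b"
  \<comment> \<open>\<open>norm d\<close> occurs on both sides; the inequality can be solved for it
    because \<open>?q < 1\<close>.\<close>
  have "norm d \<le> norm b + ?q * norm d"
  proof -
    have "norm d \<le> norm b + norm (d - b)" by (metis add.commute diff_add_cancel norm_triangle_ineq)
    also have "norm (d - b) \<le> norm (b * (a - c)) * norm d" unfolding diff by (rule norm_mult_ineq)
    also have "\<dots> \<le> ?q * norm d" using n by (rule mult_right_mono) simp
    finally show ?thesis by simp
  qed
  then have nd: "norm d \<le> norm b / (1 - ?q)"
    using assms(2) by (simp add: field_simps)
  have "norm (d - b) \<le> norm (b * (a - c)) * norm d" unfolding diff by (rule norm_mult_ineq)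
  also have "\<dots> \<le> ?q * (norm b / (1 - ?q))"
    by (rule mult_mono[OF n nd]) auto
  finally show ?thesis using d by (auto simp: inverts_def mult_ac)
qed

lemma continuous_on_inverts:
  fixes A B :: "'c::metric_space \<Rightarrow> 'a::{real_normed_algebra_1,banach}"
  assumes A: "continuous_on S A" and B: "\<And>z. z \<in> S \<Longrightarrow> inverts (A z) (B z)"
  shows "continuous_on S B"
  unfolding continuous_on_def
proof
  fix z assume z: "z \<in> S"
  have A': "(A \<longlongrightarrow> A z) (at z within S)" using A z by (auto simp: continuous_on_def)
  define q where "q = (\<lambda>w. norm (A w - A z) * norm (B z))"
  have q: "(q \<longlongrightarrow> 0) (at z within S)"
    unfolding q_def by (rule tendsto_eq_intros A' refl | simp)+
  have "eventually (\<lambda>w. q w < 1) (at z within S)"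
    using q by (rule order_tendstoD) simp
  then have ev: "eventually (\<lambda>w. norm (B w - B z) \<le> norm (B z) * q w / (1 - q w)) (at z within S)"
    unfolding eventually_at_filter
  proof eventually_elim
    case (elim w)
    show ?case
    proof (intro impI)
      assume "w \<noteq> z" "w \<in> S"
      then obtain d where d: "inverts (A w) d"
        "norm (d - B z) \<le> norm (B z) * norm (B z) * norm (A w - A z) / (1 - norm (A w - A z) * norm (B z))"
        using perturb_inverse[OF B[OF z], of "A w"] elim by (auto simp: q_def)
      have "d = B w"
        using d(1) B[OF \<open>w \<in> S\<close>] inverts_unique unfolding inverts_def by metis
      then show "norm (B w - B z) \<le> norm (B z) * q w / (1 - q w)"
        using d(2) by (simp add: q_def mult_ac)
    qed
  qed
  have "((\<lambda>w. norm (B z) * q w / (1 - q w)) \<longlongrightarrow> norm (B z) * 0 / (1 - 0)) (at z within S)"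
    by (intro tendsto_intros q) simp
  then have "((\<lambda>w. norm (B w - B z)) \<longlongrightarrow> 0) (at z within S)"
    by (intro Lim_null_comparison[where f = "\<lambda>w. norm (B w - B z)" and g = "\<lambda>w. norm (B z) * q w / (1 - q w)"])
      (use ev in auto)
  then show "(B \<longlongrightarrow> B z) (at z within S)"
    using Lim_null tendsto_norm_zero_iff by blast
qed

section \<open>Scalars and spectrum\<close>

lemma scaleC_zero_left [simp]: "scaleC 0 (x :: 'a::cstar_algebra) = 0"
  using norm_scaleC[of 0 x] by simp

lemma scaleC_zero_right [simp]: "scaleC c (0 :: 'a::cstar_algebra) = 0"
  using norm_scaleC[of c "0::'a"] by simp

lemma scaleC_minus_left: "scaleC (- c) (x :: 'a::cstar_algebra) = - scaleC c x"
  using scaleC_add_left[of c "- c" x] by (simp add: eq_neg_iff_add_eq_0 add.commute)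

lemma scaleC_minus_right: "scaleC c (- x :: 'a::cstar_algebra) = - scaleC c x"
  using scaleC_add_right[of c x "- x"] by (simp add: eq_neg_iff_add_eq_0 add.commute)

lemma scaleC_diff_left: "scaleC (c - d) (x :: 'a::cstar_algebra) = scaleC c x - scaleC d x"
  using scaleC_add_left[of c "- d" x] by (simp add: scaleC_minus_left)

lemma scaleC_diff_right: "scaleC c (x - y :: 'a::cstar_algebra) = scaleC c x - scaleC c y"
  using scaleC_add_right[of c x "- y"] by (simp add: scaleC_minus_right)

lemma scaleC_sum_right: "scaleC c (\<Sum>i\<in>I. f i :: 'a::cstar_algebra) = (\<Sum>i\<in>I. scaleC c (f i))"
  by (induction I rule: infinite_finite_induct) (auto simp: scaleC_add_right)

lemmas scaleC_simps = scaleC_add_left scaleC_add_right scaleC_diff_left scaleC_diff_right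
  scaleC_minus_left scaleC_minus_right scaleC_scaleC scaleC_mult_left scaleC_mult_right scaleC_one

lemma bounded_linear_scaleC_left: "bounded_linear (\<lambda>c. scaleC c (x :: 'a::cstar_algebra))"
  by (rule bounded_linear_intro[where K = "norm x"])
    (simp_all add: scaleC_add_left scaleR_scaleC scaleC_scaleC norm_scaleC scaleR_conv_of_real)

lemma spec_iff: "\<mu> \<in> spec x \<longleftrightarrow> \<not> is_invertible (x - scaleC \<mu> 1)"
  by (auto simp: spec_def is_invertible_def inverts_def)

lemma is_invertible_scaleC:
  fixes a :: "'a::cstar_algebra"
  assumes "c \<noteq> 0" "is_invertible a"
  shows "is_invertible (scaleC c a)"
proof -
  obtain b where "a * b = 1" "b * a = 1" using assms by (auto simp: is_invertible_def inverts_def)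
  then have "scaleC c a * scaleC (inverse c) b = 1" "scaleC (inverse c) b * scaleC c a = 1"
    using assms(1) by (simp_all add: scaleC_simps)
  then show ?thesis by (rule is_invertibleI)
qed

text \<open>The substitution z = 1/\<mu> turns the outside of a disc, where the spectrum is to be
  excluded, into a compact disc that also contains z = 0.\<close>

lemma is_invertible_minus_scaleC_iff:
  fixes a :: "'a::cstar_algebra"
  assumes "z \<noteq> 0"
  shows "is_invertible (1 - scaleC z a) \<longleftrightarrow> inverse z \<notin> spec a"
proof -
  have 1: "1 - scaleC z a = scaleC (- z) (a - scaleC (inverse z) 1)"
    using assms by (simp add: scaleC_simps)
  have 2: "a - scaleC (inverse z) 1 = scaleC (- inverse z) (1 - scaleC z a)"
    using assms by (simp add: scaleC_simps)
  show ?thesis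
    using is_invertible_scaleC[of "- z" "a - scaleC (inverse z) 1"]
      is_invertible_scaleC[of "- inverse z" "1 - scaleC z a"] assms
    unfolding spec_iff by (metis 1 2 neg_equal_0_iff_equal inverse_nonzero_iff_nonzero)
qed

lemma spec_norm_le:
  fixes x :: "'a::cstar_algebra"
  assumes "\<mu> \<in> spec x"
  shows "cmod \<mu> \<le> norm x"
proof (rule ccontr)
  assume n: "\<not> ?thesis"
  then have "\<mu> \<noteq> 0" by auto
  moreover have "norm (scaleC (inverse \<mu>) x) < 1"
    using n \<open>\<mu> \<noteq> 0\<close> by (simp add: norm_scaleC norm_inverse flip: divide_inverse_commute)
  then have "is_invertible (1 - scaleC (inverse \<mu>) x)"
    using neumann_inverse unfolding is_invertible_def by blast
  ultimately show False
    using is_invertible_minus_scaleC_iff[of "inverse \<mu>" x] assms by simp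
qed

lemma closed_spec: "closed (spec (x :: 'a::cstar_algebra))"
proof -
  have "\<exists>e>0. ball \<mu> e \<subseteq> - spec x" if \<mu>: "\<mu> \<notin> spec x" for \<mu>
  proof -
    obtain b where b: "inverts (x - scaleC \<mu> 1) b" using \<mu> by (auto simp: spec_iff is_invertible_def)
    have pos: "1 / (norm b + 1) > 0" by (simp add: add_nonneg_pos)
    show ?thesis
    proof (intro exI conjI, rule pos, rule subsetI)
      fix \<nu> assume "\<nu> \<in> ball \<mu> (1 / (norm b + 1))"
      then have d: "cmod (\<mu> - \<nu>) < 1 / (norm b + 1)" by (simp add: dist_norm)
      have "norm ((x - scaleC \<nu> 1) - (x - scaleC \<mu> 1)) = cmod (\<mu> - \<nu>)"
        using norm_scaleC[of "\<mu> - \<nu>" "1::'a"] by (simp add: scaleC_diff_left)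
      moreover have "cmod (\<mu> - \<nu>) * norm b \<le> cmod (\<mu> - \<nu>) * (norm b + 1)"
        by (simp add: mult_left_mono)
      moreover have "cmod (\<mu> - \<nu>) * (norm b + 1) < 1"
        using d by (simp add: pos_less_divide_eq add_nonneg_pos)
      ultimately have "is_invertible (x - scaleC \<nu> 1)"
        using perturb_inverse[OF b, of "x - scaleC \<nu> 1"] by (auto simp: is_invertible_def)
      then show "\<nu> \<in> - spec x" by (simp add: spec_iff)
    qed
  qed
  then have "open (- spec x)" by (simp add: open_contains_ball)
  then show ?thesis by (simp add: closed_def)
qed

lemma compact_spec: "compact (spec (x :: 'a::cstar_algebra))"
  unfolding compact_eq_bounded_closed
  using closed_spec spec_norm_le by (auto intro: boundedI)

section \<open>Hermitian elements\<close>

lemma adj_one [simp]: "adj (1 :: 'a::cstar_algebra) = 1"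
  by (metis adj_adj adj_mult mult_1_left mult_1_right)

lemma adj_zero [simp]: "adj (0 :: 'a::cstar_algebra) = 0"
  by (metis add_cancel_right_right adj_add)

lemma norm_adj: "norm (adj x) = norm (x :: 'a::cstar_algebra)"
proof -
  have le: "norm y \<le> norm (adj y)" for y :: 'a
  proof (cases "y = 0")
    case False
    have "norm y * norm y \<le> norm (adj y) * norm y"
      using cstar_identity[of y] norm_mult_ineq[of "adj y" y] by simp
    then show ?thesis using False by simp
  qed simp
  show ?thesis using le[of x] le[of "adj x"] by (simp add: adj_adj)
qed

lemma hermitian_add: "x \<in> hermitian_elems \<Longrightarrow> y \<in> hermitian_elems \<Longrightarrow> x + y \<in> hermitian_elems"
  by (simp add: hermitian_elems_def adj_add)

lemma hermitian_scaleR: "x \<in> hermitian_elems \<Longrightarrow> r *\<^sub>R x \<in> hermitian_elems"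
  by (simp add: hermitian_elems_def scaleR_scaleC adj_scaleC)

lemma hermitian_diff: "x \<in> hermitian_elems \<Longrightarrow> y \<in> hermitian_elems \<Longrightarrow> x - y \<in> hermitian_elems"
  using hermitian_add[of x "(-1) *\<^sub>R y"] hermitian_scaleR[of y "-1"] by simp

lemma hermitian_adj_mult: "adj x * x \<in> hermitian_elems"
  by (simp add: hermitian_elems_def adj_mult adj_adj)

lemma hermitian_power: "x \<in> hermitian_elems \<Longrightarrow> x ^ n \<in> hermitian_elems"
  by (induction n) (auto simp: hermitian_elems_def adj_mult power_commutes)

text \<open>The exponents are powers of two because each use of the C*-identity doubles the
  exponent.\<close>

lemma norm_hermitian_power:
  assumes "x \<in> hermitian_elems"
  shows "norm (x ^ (2 ^ k)) = norm x ^ (2 ^ k)"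
proof (induction k)
  case (Suc k)
  let ?y = "x ^ (2 ^ k)"
  have "adj ?y = ?y" using hermitian_power[OF assms] by (simp add: hermitian_elems_def)
  then have "norm (?y * ?y) = norm ?y * norm ?y" using cstar_identity[of ?y] by simp
  then show ?case by (simp add: Suc mult_2 power_add)
qed simp

lemma spec_shift: "\<mu> \<in> spec x \<Longrightarrow> \<mu> + c \<in> spec (x + scaleC c 1)"
  by (simp add: spec_iff scaleC_add_left algebra_simps)

text \<open>Adding \<open>\<i> * t\<close> moves the spectrum by \<open>t\<close> along the
  imaginary axis, while the C*-identity lets the squared norm grow by at most t^2. In
  \<open>key\<close> the squares of \<open>t\<close> cancel, and the remaining term, linear in
  \<open>t\<close>, cannot stay bounded unless \<open>Im \<mu> = 0\<close>.\<close>

lemma spec_hermitian_real: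
  fixes x :: "'a::cstar_algebra"
  assumes x: "x \<in> hermitian_elems" and \<mu>: "\<mu> \<in> spec x"
  shows "\<mu> = complex_of_real (Re \<mu>)"
proof -
  have ax: "adj x = x" using x by (simp add: hermitian_elems_def)
  have key: "(Re \<mu>)\<^sup>2 + (Im \<mu> + t)\<^sup>2 \<le> (norm x)\<^sup>2 + t\<^sup>2" for t :: real
  proof -
    let ?y = "x + scaleC (\<i> * t) 1"
    have "?y * adj ?y = x * x + scaleC (of_real (t\<^sup>2)) 1"
      by (simp add: adj_add adj_scaleC ax scaleC_simps algebra_simps power2_eq_square)
    then have "norm (adj ?y) * norm (adj ?y) = norm (x * x + scaleC (of_real (t\<^sup>2)) 1)"
      using cstar_identity[of "adj ?y"] by (simp add: adj_adj)
    also have "\<dots> \<le> norm (x * x) + norm (scaleC (of_real (t\<^sup>2)) (1::'a))" by (rule norm_triangle_ineq)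
    also have "\<dots> \<le> (norm x)\<^sup>2 + t\<^sup>2"
      using norm_mult_ineq[of x x] by (simp add: norm_scaleC power2_eq_square norm_mult)
    finally have n: "(norm ?y)\<^sup>2 \<le> (norm x)\<^sup>2 + t\<^sup>2" by (simp add: norm_adj power2_eq_square)
    have "cmod (\<mu> + \<i> * t) \<le> norm ?y" by (rule spec_norm_le, rule spec_shift, rule \<mu>)
    then have "(cmod (\<mu> + \<i> * t))\<^sup>2 \<le> (norm ?y)\<^sup>2" by (rule power_mono) simp
    then show ?thesis using n by (simp add: cmod_power2)
  qed
  have "Im \<mu> = 0"
  proof (rule ccontr)
    assume ne: "Im \<mu> \<noteq> 0"
    have "2 * t * Im \<mu> \<le> (norm x)\<^sup>2" for t
    proof -
      have "(Im \<mu> + t)\<^sup>2 = (Im \<mu>)\<^sup>2 + t\<^sup>2 + 2 * t * Im \<mu>" by (simp add: power2_sum)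
      then show ?thesis using key[of t] zero_le_power2[of "Re \<mu>"] zero_le_power2[of "Im \<mu>"] by linarith
    qed
    \<comment> \<open>This \<open>t\<close> makes the left-hand side equal to
      \<open>(norm x)\<^sup>2 + 1\<close>.\<close>
    from this[of "((norm x)\<^sup>2 + 1) / (2 * Im \<mu>)"] show False using ne by simp
  qed
  then show ?thesis by (simp add: complex_eq_iff)
qed

section \<open>Averages of resolvents over roots of unity\<close>

text \<open>Multiplying \<open>z\<close> by this root of unity flips the sign of
  \<open>z ^ 2 ^ k\<close>, so that the inverses of \<open>1 - w\<close> and \<open>1 + w\<close>
  are values of one function at two points of the same circle.\<close>

lemma cis_half_power: "cis (pi / 2 ^ k) ^ (2 ^ k) = - 1"
  by (simp add: Complex.DeMoivre)

text \<open>This is the partial fraction decomposition 1/(1 - w^2) = (1/(1 - w) + 1/(1 +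
  w))/2.\<close>

lemma inverts_average:
  fixes w :: "'a::cstar_algebra"
  assumes "inverts (1 - w) a" "inverts (1 + w) b"
  shows "inverts (1 - w * w) ((1/2) *\<^sub>R (a + b))"
proof -
  have "(1 - w * w) * a = (1 + w) * ((1 - w) * a)" by (simp add: algebra_simps)
  then have 1: "(1 - w * w) * a = 1 + w" using assms(1) by (simp add: inverts_def)
  have "(1 - w * w) * b = (1 - w) * ((1 + w) * b)" by (simp add: algebra_simps)
  then have 2: "(1 - w * w) * b = 1 - w" using assms(2) by (simp add: inverts_def)
  have "a * (1 - w * w) = (a * (1 - w)) * (1 + w)" by (simp add: algebra_simps)
  then have 3: "a * (1 - w * w) = 1 + w" using assms(1) by (simp add: inverts_def)
  have "b * (1 - w * w) = (b * (1 + w)) * (1 - w)" by (simp add: algebra_simps)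
  then have 4: "b * (1 - w * w) = 1 - w" using assms(2) by (simp add: inverts_def)
  have 5: "(1/2) *\<^sub>R ((1 + w) + (1 - w)) = 1" by (simp add: scaleR_2[symmetric] del: scaleR_2)
  show ?thesis
    unfolding inverts_def mult_scaleR_right mult_scaleR_left distrib_left distrib_right 1 2 3 4 5 by simp
qed

text \<open>Rickart's argument: if the resolvent $F_0(z) = (1 - z h)^{-1}$ exists on the closed disc
  whose radius is the inverse of the norm of $h$, then so do its averages
  $F_k(z) = (1 - z^n h^n)^{-1}$ over the $n$-th roots of unity, $n = 2^k$, with the same modulus of
  continuity. Inside the disc they tend to 1; on its boundary they cannot, since $z^n h^n$ has norm 1.\<close>
lemma hermitian_spec_norm_attained:
  fixes h :: "'a::cstar_algebra"
  assumes h: "h \<in> hermitian_elems"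
  shows "\<exists>\<mu>\<in>spec h. cmod \<mu> = norm h"
proof (cases "h = 0")
  case True
  have "\<not> is_invertible (0 :: 'a)" by (auto simp: is_invertible_def inverts_def)
  then have "0 \<in> spec h" using True by (simp add: spec_iff)
  then show ?thesis using True by force
next
  case False
  define r where "r = 1 / norm h"
  have r: "r > 0" "r * norm h = 1" using False by (auto simp: r_def)
  show ?thesis
  proof (rule ccontr)
    assume no: "\<not> ?thesis"
    have inv: "is_invertible (1 - scaleC z h)" if z: "cmod z \<le> r" for z
    proof (cases "z = 0")
      case True
      show ?thesis unfolding True by (rule is_invertibleI[of _ 1 1]) auto
    next
      case nz: False
      have "norm h \<le> cmod (inverse z)"
        using z nz False by (simp add: r_def norm_inverse norm_divide field_simps)
      then have "inverse z \<notin> spec h"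
        using no spec_norm_le[of "inverse z" h] by force
      then show ?thesis using is_invertible_minus_scaleC_iff[OF nz, of h] by simp
    qed
    define F0 where "F0 = (\<lambda>z. SOME b. inverts (1 - scaleC z h) b)"
    have F0: "inverts (1 - scaleC z h) (F0 z)" if "cmod z \<le> r" for z
      unfolding F0_def using inv[OF that] by (auto simp: is_invertible_def intro: someI_ex)
    have "continuous_on (cball 0 r) F0"
    proof (rule continuous_on_inverts)
      show "continuous_on (cball 0 r) (\<lambda>z. 1 - scaleC z h)"
        by (intro continuous_intros bounded_linear.continuous_on[OF bounded_linear_scaleC_left])
      show "\<And>z. z \<in> cball 0 r \<Longrightarrow> inverts (1 - scaleC z h) (F0 z)"
        using F0 by simp
    qed
    then have "uniformly_continuous_on (cball 0 r) F0"
      by (rule compact_uniformly_continuous) simp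
    \<comment> \<open>The tolerance 1/5 is fixed by the end of the proof: with the error 1/10 inside
      the disc it gives \<open>norm e\<close> \<le> 3/10, while \<open>norm w = 1\<close> will force
      \<open>norm e\<close> \<ge> 1/2.\<close>
    then obtain d where d: "d > 0"
      "\<And>z w. z \<in> cball 0 r \<Longrightarrow> w \<in> cball 0 r \<Longrightarrow> dist w z < d \<Longrightarrow> dist (F0 w) (F0 z) < 1/5"
      unfolding uniformly_continuous_on_def by (metis zero_less_divide_1_iff zero_less_numeral)
    \<comment> \<open>The term \<open>1 - d / (2 * r)\<close> brings \<open>t * z\<close> within
      distance \<open>d\<close> of \<open>z\<close> when \<open>cmod z = r\<close>; the
      \<open>1/2\<close> keeps \<open>t\<close> positive.\<close>
    define t where "t = max (1/2) (1 - d / (2 * r))"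
    have t: "0 < t" "t < 1" "(1 - t) * r < d"
      using d(1) r(1) by (auto simp: t_def max_def field_simps)
    \<comment> \<open>The average over 2^k-th roots of unity is built by doubling:
      \<open>cis (pi / 2 ^ k)\<close> is a primitive root of order 2^(k+1) and carries the roots of
      order 2^k to the missing ones.\<close>
    define F where "F = rec_nat F0 (\<lambda>k G z. (1/2) *\<^sub>R (G z + G (cis (pi / 2 ^ k) * z)))"
    have F_0: "F 0 = F0" and F_Suc: "F (Suc k) z = (1/2) *\<^sub>R (F k z + F k (cis (pi / 2 ^ k) * z))" for k z
      by (simp_all add: F_def)
    have F_inv: "inverts (1 - scaleC (z ^ 2 ^ k) (h ^ 2 ^ k)) (F k z)" if "cmod z \<le> r" for z k
      using that
    proof (induction k arbitrary: z)
      case 0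
      then show ?case using F0 by (simp add: F_0)
    next
      case (Suc k)
      let ?w = "scaleC (z ^ 2 ^ k) (h ^ 2 ^ k)"
      have 1: "inverts (1 - ?w) (F k z)" by (rule Suc.IH[OF Suc.prems])
      have "cmod (cis (pi / 2 ^ k) * z) \<le> r" using Suc.prems by (simp add: norm_mult)
      from Suc.IH[OF this] have 2: "inverts (1 + ?w) (F k (cis (pi / 2 ^ k) * z))"
        by (simp add: power_mult_distrib cis_half_power scaleC_minus_left)
      have 3: "?w * ?w = scaleC (z ^ 2 ^ Suc k) (h ^ 2 ^ Suc k)"
        by (simp add: scaleC_simps mult_2 power_add)
      show ?case using inverts_average[OF 1 2] unfolding 3 F_Suc .
    qed
    have F_close: "norm (F k (of_real t * z) - F k z) \<le> 1/5" if "cmod z = r" for z k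
      using that
    proof (induction k arbitrary: z)
      case 0
      have tr: "t * r \<le> 1 * r" by (rule mult_right_mono) (use t r in auto)
      have "of_real t * z - z = of_real (t - 1) * z" by (simp add: algebra_simps)
      then have "dist (of_real t * z) z < d"
        using 0 t by (simp add: dist_norm norm_mult del: of_real_diff)
      then have "dist (F0 (of_real t * z)) (F0 z) < 1/5"
        using 0 t r tr by (intro d(2)) (auto simp: norm_mult)
      then show ?case by (simp add: F_0 dist_norm)
    next
      case (Suc k)
      let ?c = "cis (pi / 2 ^ k)"
      have 1: "norm (F k (of_real t * z) - F k z) \<le> 1/5" by (rule Suc.IH[OF Suc.prems])
      have 2: "norm (F k (of_real t * (?c * z)) - F k (?c * z)) \<le> 1/5"
        by (rule Suc.IH) (use Suc.prems in \<open>simp add: norm_mult\<close>)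
      have "F (Suc k) (of_real t * z) - F (Suc k) z
        = (1/2) *\<^sub>R ((F k (of_real t * z) - F k z) + (F k (of_real t * (?c * z)) - F k (?c * z)))"
        by (simp add: F_Suc algebra_simps)
      also have "norm \<dots> \<le> (1/2) * (1/5 + 1/5)"
        using norm_triangle_mono[OF 1 2] by simp
      finally show ?case by simp
    qed
    have "(\<lambda>n. t ^ n) \<longlonglongrightarrow> 0" using t by (intro LIMSEQ_realpow_zero) auto
    then have "eventually (\<lambda>n. t ^ n < 1/20) sequentially" by (rule order_tendstoD) simp
    then obtain k where "t ^ k < 1/20" by (auto simp: eventually_sequentially)
    moreover have "t ^ 2 ^ k \<le> t ^ k" using t by (intro power_decreasing) (auto intro: less_imp_le)
    ultimately have tk: "t ^ 2 ^ k < 1/20" by simp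
    let ?z = "complex_of_real r"
    define w where "w = scaleC (?z ^ 2 ^ k) (h ^ 2 ^ k)"
    have nw: "norm w = 1"
      using r less_imp_le[OF r(1)] by (simp add: w_def norm_scaleC norm_hermitian_power[OF h] norm_power flip: power_mult_distrib)
    have z: "cmod ?z = r" using r by simp
    have F1: "inverts (1 - w) (F k ?z)" unfolding w_def by (rule F_inv) (simp add: r(1) less_imp_le)
    have "cmod (of_real t * ?z) \<le> r" using t r less_imp_le[OF r(1)] by (simp add: norm_mult mult_left_le_one_le)
    from F_inv[OF this, of k] have F2: "inverts (1 - scaleC (of_real t ^ 2 ^ k) w) (F k (of_real t * ?z))"
      by (simp add: w_def scaleC_scaleC power_mult_distrib)
    have nt: "norm (scaleC (of_real t ^ 2 ^ k) w) = t ^ 2 ^ k" using t nw by (simp add: norm_scaleC norm_power)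
    then obtain b where b: "inverts (1 - scaleC (of_real t ^ 2 ^ k) w) b" "norm b \<le> 1 / (1 - t ^ 2 ^ k)"
      using neumann_inverse[of "scaleC (of_real t ^ 2 ^ k) w"] tk by auto
    have "b = F k (of_real t * ?z)" using b(1) F2 inverts_unique unfolding inverts_def by metis
    have "b - 1 = scaleC (of_real t ^ 2 ^ k) w * b"
      using b(1) by (simp add: inverts_def algebra_simps)
    then have "norm (b - 1) \<le> t ^ 2 ^ k * norm b" using norm_mult_ineq nt by metis
    also have "\<dots> \<le> (1/20) * 2"
    proof (rule mult_mono)
      have "1 / (1 - t ^ 2 ^ k) \<le> 2" using tk by (simp add: field_simps)
      then show "norm b \<le> 2" using b(2) by linarith
    qed (use tk in auto)
    finally have b1: "norm (b - 1) \<le> 1/10" by simp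
    define e where "e = F k ?z - 1"
    have "norm e \<le> norm (b - 1) + norm (b - F k ?z)"
      using norm_triangle_ineq4[of "b - 1" "b - F k ?z"] by (simp add: e_def)
    then have ne: "norm e \<le> 3/10"
      using F_close[OF z, of k] b1 \<open>b = F k (of_real t * ?z)\<close> by simp
    \<comment> \<open>This is (1 - w)(1 + e) = 1 multiplied out. Taking norms gives 1 \<le> 2 *
      \<open>norm e\<close>.\<close>
    have "w = e - w * e" using F1 by (simp add: inverts_def e_def algebra_simps)
    then have "norm w \<le> norm e + norm (w * e)" by (metis norm_triangle_ineq4)
    then have "norm w \<le> norm e + norm w * norm e" using norm_mult_ineq[of w e] by linarith
    then show False using nw ne by simp
  qed
qed

section \<open>Polynomials in an element\<close>

definition del :: "nat \<Rightarrow> 'b list \<Rightarrow> 'b list" where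
  "del i hs = take i hs @ drop (Suc i) hs"

text \<open>The coefficient of $t_1 \cdots t_k$ in $p(x + t_1 h_1 + \dots + t_k h_k)$, which is the
  value of the $k$-th derivative of $p$ at $x$ in the directions $h_1, \dots, h_k$.\<close>
definition poly_deriv_at :: "'a::cstar_algebra \<Rightarrow> complex poly \<Rightarrow> 'a list \<Rightarrow> 'a" where
  "poly_deriv_at x p = fold_coeffs (\<lambda>a F hs. (if hs = [] then scaleC a 1 else 0) + x * F hs
      + (\<Sum>i<length hs. hs ! i * F (del i hs))) p (\<lambda>_. 0)"

lemma poly_deriv_at_0 [simp]: "poly_deriv_at x 0 hs = 0"
  by (simp add: poly_deriv_at_def)

text \<open>Horner's rule at x + \<Sum> t_i h_i: the leftmost factor contributes either
  \<open>x\<close>, leaving all directions to \<open>p\<close>, or one \<open>h_i\<close>, leaving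
  the others. The constant \<open>a\<close> contains no t_i, so it counts only for the empty
  list.\<close>

lemma poly_deriv_at_pCons: "poly_deriv_at x (pCons a p) hs =
   (if hs = [] then scaleC a 1 else 0) + x * poly_deriv_at x p hs
    + (\<Sum>i<length hs. hs ! i * poly_deriv_at x p (del i hs))"
proof (cases "a = 0 \<and> p = 0")
  case False
  then show ?thesis
    unfolding poly_deriv_at_def
    by (cases "a = 0") (simp_all add: fold_coeffs_pCons_not_0_0_eq fold_coeffs_pCons_coeff_not_0_eq)
qed auto

lemma length_del [simp]: "i < length hs \<Longrightarrow> length (del i hs) = length hs - 1"
  by (simp add: del_def)

lemma poly_deriv_at_add: "poly_deriv_at x (p + q) hs = poly_deriv_at x p hs + poly_deriv_at x q hs"
  by (induction p q arbitrary: hs rule: poly_induct2)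
    (auto simp: poly_deriv_at_pCons algebra_simps scaleC_add_left sum.distrib)

lemma poly_deriv_at_smult: "poly_deriv_at x (smult c p) hs = scaleC c (poly_deriv_at x p hs)"
  by (induction p arbitrary: hs)
    (auto simp: poly_deriv_at_pCons scaleC_simps scaleC_sum_right)

lemma poly_deriv_at_minus: "poly_deriv_at x (- p) hs = - poly_deriv_at x p hs"
  using poly_deriv_at_smult[of x "-1" p hs] by (simp add: scaleC_minus_left scaleC_one)

lemma poly_deriv_at_diff: "poly_deriv_at x (p - q) hs = poly_deriv_at x p hs - poly_deriv_at x q hs"
  using poly_deriv_at_add[of x p "- q"] by (simp add: poly_deriv_at_minus)

lemma poly_deriv_at_sum: "poly_deriv_at x (\<Sum>i\<in>I. f i) hs = (\<Sum>i\<in>I. poly_deriv_at x (f i) hs)"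
  by (induction I rule: infinite_finite_induct) (auto simp: poly_deriv_at_add)

abbreviation poly_at :: "'a::cstar_algebra \<Rightarrow> complex poly \<Rightarrow> 'a" where
  "poly_at x p \<equiv> poly_deriv_at x p []"

lemma poly_at_pCons: "poly_at x (pCons a p) = scaleC a 1 + x * poly_at x p"
  by (simp add: poly_deriv_at_pCons)

lemma poly_at_const: "poly_at x [:a:] = scaleC a 1"
  by (simp add: poly_at_pCons)

lemma poly_at_1: "poly_at x 1 = 1"
  by (simp add: poly_at_const one_pCons scaleC_one)

lemma poly_at_mult: "poly_at x (p * q) = poly_at x p * poly_at x q"
  by (induction p) (simp_all add: poly_at_pCons poly_deriv_at_add poly_deriv_at_smult algebra_simps scaleC_simps)

lemma poly_at_altdef: "poly_at x p = (\<Sum>i\<le>degree p. scaleC (coeff p i) (x ^ i))"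
proof (induction p)
  case (pCons a p)
  show ?case
  proof (cases "p = 0")
    case False
    have "(\<Sum>i\<le>degree (pCons a p). scaleC (coeff (pCons a p) i) (x ^ i))
        = scaleC a 1 + x * (\<Sum>i\<le>degree p. scaleC (coeff p i) (x ^ i))"
      using False by (simp add: degree_pCons_eq sum.atMost_Suc_shift sum_distrib_left scaleC_mult_right
          del: sum.atMost_Suc)
    then show ?thesis by (simp add: poly_at_pCons pCons.IH)
  qed (simp add: poly_at_pCons)
qed simp

lemma poly_at_commute: "poly_at x p * poly_at x q = poly_at x q * poly_at x p"
  by (metis mult.commute poly_at_mult)

lemma adj_poly_at:
  assumes "x \<in> hermitian_elems"
  shows "adj (poly_at x p) = poly_at x (map_poly cnj p)"
proof (induction p)
  case (pCons a p)
  have "adj x = x" using assms by (simp add: hermitian_elems_def)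
  moreover have "poly_at x q * x = x * poly_at x q" for q
    using poly_at_commute[of x q "[:0,1:]"] by (simp add: poly_at_pCons scaleC_one)
  moreover have "map_poly cnj (pCons a p) = pCons (cnj a) (map_poly cnj p)"
    by (cases "p = 0 \<and> a = 0") (auto intro: map_poly_pCons)
  ultimately show ?case
    using pCons.IH by (simp add: poly_at_pCons adj_add adj_mult adj_scaleC)
qed simp

section \<open>Spectral mapping\<close>

text \<open>p - p(\<mu>) has the factor X - \<mu>, and the two factors commute at \<open>x\<close>;
  if the product were invertible, \<open>x - scaleC \<mu> 1\<close> would be too.\<close>

lemma poly_at_spec:
  assumes "\<mu> \<in> spec x"
  shows "poly p \<mu> \<in> spec (poly_at x p)"
proof -
  obtain q where q: "p - [:poly p \<mu>:] = [:- \<mu>, 1:] * q"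
    using poly_eq_0_iff_dvd[of "p - [:poly p \<mu>:]" \<mu>] by (auto elim: dvdE)
  have "poly_at x p - scaleC (poly p \<mu>) 1 = poly_at x (p - [:poly p \<mu>:])"
    by (simp add: poly_deriv_at_diff poly_at_const)
  also have "\<dots> = poly_at x [:- \<mu>, 1:] * poly_at x q"
    unfolding q by (rule poly_at_mult)
  finally have 1: "poly_at x p - scaleC (poly p \<mu>) 1 = poly_at x [:- \<mu>, 1:] * poly_at x q" .
  have 2: "poly_at x [:- \<mu>, 1:] = x - scaleC \<mu> 1"
    by (simp add: poly_at_pCons scaleC_one scaleC_minus_left)
  show ?thesis
    using assms is_invertible_factor[OF poly_at_commute, of x "[:- \<mu>, 1:]" q] unfolding spec_iff 1 2 by auto
qed

text \<open>Over the complex numbers \<open>p\<close> splits into linear factors, each of which is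
  invertible at \<open>x\<close>.\<close>

lemma is_invertible_poly_at:
  assumes "p \<noteq> 0" "\<And>\<mu>. poly p \<mu> = 0 \<Longrightarrow> \<mu> \<notin> spec x"
  shows "is_invertible (poly_at x p)"
  using assms
proof (induction "degree p" arbitrary: p)
  case 0
  then obtain c where "p = [:c:]" by (metis degree_eq_zeroE)
  then show ?case
    using 0 is_invertible_scaleC[of c 1] is_invertibleI[of 1 1 1] by (simp add: poly_at_const)
next
  case (Suc n)
  then obtain \<mu> where \<mu>: "poly p \<mu> = 0"
    using fundamental_theorem_of_algebra[of p] by (metis constant_degree nat.distinct(1))
  then obtain q where q: "p = [:- \<mu>, 1:] * q" by (metis poly_eq_0_iff_dvd dvdE)
  have "q \<noteq> 0" using Suc.prems(1) q by auto
  then have "degree p = Suc (degree q)" unfolding q by (subst degree_mult_eq) auto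
  then have "is_invertible (poly_at x q)"
    using Suc \<open>q \<noteq> 0\<close> by (intro Suc.hyps(1)) (auto simp: q)
  moreover have "poly_at x [:- \<mu>, 1:] = x - scaleC \<mu> 1"
    by (simp add: poly_at_pCons scaleC_one scaleC_minus_left)
  then have "is_invertible (poly_at x [:- \<mu>, 1:])"
    using Suc.prems(2)[OF \<mu>] by (simp add: spec_iff)
  ultimately show ?case unfolding q poly_at_mult by (rule is_invertible_mult[rotated])
qed

lemma spec_poly_at:
  assumes "spec x \<noteq> {}" "\<nu> \<in> spec (poly_at x p)"
  shows "\<nu> \<in> poly p ` spec x"
proof (rule ccontr)
  assume no: "\<not> ?thesis"
  \<comment> \<open>If \<open>p\<close> were the constant \<nu>, any point of the nonempty spectrum
    would be mapped to \<nu>.\<close>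
  then have "p \<noteq> [:\<nu>:]" using assms(1) by auto
  then have "is_invertible (poly_at x (p - [:\<nu>:]))"
    using no by (intro is_invertible_poly_at) auto
  then show False using assms(2) by (simp add: spec_iff poly_deriv_at_diff poly_at_const)
qed

lemma spec_hermitian_nonempty: "x \<in> hermitian_elems \<Longrightarrow> spec x \<noteq> {}"
  using hermitian_spec_norm_attained by blast

lemma norm_poly_at_ge: "\<mu> \<in> spec x \<Longrightarrow> cmod (poly p \<mu>) \<le> norm (poly_at x p)"
  by (intro spec_norm_le poly_at_spec)

lemma poly_map_cnj_real: "poly (map_poly cnj p) (of_real t) = cnj (poly p (of_real t))"
  using poly_cnj[of p "of_real t"] by simp

lemma poly_add_fun: "poly (p + q) = (\<lambda>z. poly p z + poly q z)"
  and poly_diff_fun: "poly (p - q) = (\<lambda>z. poly p z - poly q z)"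
  and poly_mult_fun: "poly (p * q) = (\<lambda>z. poly p z * poly q z)"
  for p q :: "complex poly"
  by auto

text \<open>p(x) need not be Hermitian, but adj(p(x)) p(x) is, and it is again a polynomial in
  \<open>x\<close>. Its norm is attained on its spectrum, hence by spectral mapping at some \<mu> in
  \<open>spec x\<close>. As \<mu> is real, the value there is the square of |p(\<mu>)|, and the
  C*-identity removes the squares.\<close>

lemma norm_poly_at_attained:
  assumes x: "x \<in> hermitian_elems"
  shows "\<exists>\<mu>\<in>spec x. cmod (poly p \<mu>) = norm (poly_at x p)"
proof -
  let ?h = "poly_at x (map_poly cnj p * p)"
  have h: "?h = adj (poly_at x p) * poly_at x p"
    by (simp add: poly_at_mult adj_poly_at[OF x])
  then obtain \<nu> where \<nu>: "\<nu> \<in> spec ?h" "cmod \<nu> = norm ?h"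
    using hermitian_spec_norm_attained hermitian_adj_mult by metis
  then obtain \<mu> where \<mu>: "\<mu> \<in> spec x" "\<nu> = poly (map_poly cnj p * p) \<mu>"
    using spec_poly_at[OF spec_hermitian_nonempty[OF x] \<nu>(1)] by auto
  have "cmod \<nu> = cmod (poly p \<mu>) * cmod (poly p \<mu>)"
    unfolding \<mu>(2) by (subst (1 2 3) spec_hermitian_real[OF x \<mu>(1)])
      (simp add: norm_mult poly_map_cnj_real)
  moreover have "norm ?h = norm (poly_at x p) * norm (poly_at x p)"
    unfolding h by (rule cstar_identity)
  ultimately have "(cmod (poly p \<mu>))\<^sup>2 = (norm (poly_at x p))\<^sup>2"
    using \<nu>(2) by (simp add: power2_eq_square)
  then show ?thesis using \<mu>(1) by (auto simp: power2_eq_iff_nonneg)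
qed

lemma norm_poly_at_le:
  assumes "x \<in> hermitian_elems" "\<And>t. \<bar>t\<bar> \<le> norm x \<Longrightarrow> cmod (poly p (of_real t)) \<le> M"
  shows "norm (poly_at x p) \<le> M"
proof -
  obtain \<mu> where \<mu>: "\<mu> \<in> spec x" "cmod (poly p \<mu>) = norm (poly_at x p)"
    using norm_poly_at_attained[OF assms(1)] by blast
  have r: "\<mu> = of_real (Re \<mu>)" by (rule spec_hermitian_real[OF assms(1) \<mu>(1)])
  have "\<bar>Re \<mu>\<bar> \<le> norm x" using spec_norm_le[OF \<mu>(1)] abs_Re_le_cmod order_trans by blast
  then have "cmod (poly p \<mu>) \<le> M" by (subst r) (rule assms(2))
  then show ?thesis using \<mu>(2) by simp
qed

section \<open>Existence of the functional calculus\<close>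

lemma real_polynomial_function_poly:
  fixes f :: "real \<Rightarrow> real"
  assumes "real_polynomial_function f"
  shows "\<exists>p. \<forall>t. poly p (complex_of_real t) = of_real (f t)"
proof -
  obtain a n where f: "f = (\<lambda>x. \<Sum>i\<le>n. a i * x ^ i)"
    using assms real_polynomial_function_iff_sum by blast
  have "poly (\<Sum>i\<le>n. monom (of_real (a i)) i) (complex_of_real t) = of_real (f t)" for t
    by (simp add: f poly_sum poly_monom)
  then show ?thesis by blast
qed

lemma weierstrass_complex_poly:
  fixes f :: "real \<Rightarrow> complex"
  assumes "compact S" "continuous_on S f" "e > 0"
  shows "\<exists>p. \<forall>t\<in>S. cmod (poly p (of_real t) - f t) < e"
proof -
  obtain g where g: "polynomial_function g" "\<And>t. t \<in> S \<Longrightarrow> norm (f t - g t) < e"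
    using Stone_Weierstrass_polynomial_function[OF assms] by blast
  have "real_polynomial_function (Re \<circ> g)" "real_polynomial_function (Im \<circ> g)"
    using g(1) bounded_linear_Re bounded_linear_Im unfolding polynomial_function_def by auto
  then obtain p q where p: "\<And>t. poly p (complex_of_real t) = of_real (Re (g t))"
    and q: "\<And>t. poly q (complex_of_real t) = of_real (Im (g t))"
    using real_polynomial_function_poly by (metis comp_apply)
  have "poly (p + smult \<i> q) (of_real t) = g t" for t
    by (simp add: p q complex_eq_iff)
  then show ?thesis using g(2) by (metis norm_minus_commute)
qed

text \<open>Polynomials in z alone, without its conjugate, are dense because the spectrum is a
  compact subset of the real line.\<close>

lemma poly_dense_on_spec:
  assumes x: "x \<in> hermitian_elems" and f: "continuous_on (spec x) f" and e: "e > 0"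
  shows "\<exists>p. \<forall>z\<in>spec x. cmod (poly p z - f z) < e"
proof -
  let ?S = "Re ` spec x"
  have r: "of_real (Re z) = z" if "z \<in> spec x" for z
    using spec_hermitian_real[OF x that] by simp
  have "compact ?S"
    by (intro compact_continuous_image compact_spec continuous_intros)
  moreover have "continuous_on ?S (\<lambda>t. f (of_real t))"
    by (rule continuous_on_compose2[OF f]) (use r in \<open>auto intro!: continuous_intros\<close>)
  ultimately obtain p where "\<forall>t\<in>?S. cmod (poly p (of_real t) - f (of_real t)) < e"
    using weierstrass_complex_poly e by blast
  then show ?thesis using r by (intro exI[of _ p]) force
qed

definition approx_on_spec :: "'a::cstar_algebra \<Rightarrow> (complex \<Rightarrow> complex) \<Rightarrow> nat \<Rightarrow> complex poly" where
  "approx_on_spec x f n = (SOME p. \<forall>z\<in>spec x. cmod (poly p z - f z) < 1 / real (Suc n))"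

definition func_calc :: "'a::cstar_algebra \<Rightarrow> (complex \<Rightarrow> complex) \<Rightarrow> 'a" where
  "func_calc x f = lim (\<lambda>n. poly_at x (approx_on_spec x f n))"

lemma uniform_limit_approx_on_spec:
  assumes "x \<in> hermitian_elems" "continuous_on (spec x) f"
  shows "uniform_limit (spec x) (\<lambda>n. poly (approx_on_spec x f n)) f sequentially"
proof (rule uniform_limitI)
  fix e :: real assume "e > 0"
  then obtain N where N: "1 / real (Suc N) < e" using nat_approx_posE by blast
  have a: "\<forall>z\<in>spec x. cmod (poly (approx_on_spec x f n) z - f z) < 1 / real (Suc n)" for n
    unfolding approx_on_spec_def by (rule someI_ex, rule poly_dense_on_spec[OF assms]) simp
  show "\<forall>\<^sub>F n in sequentially. \<forall>z\<in>spec x. dist (poly (approx_on_spec x f n) z) (f z) < e"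
    unfolding eventually_sequentially
  proof (intro exI allI impI ballI)
    fix n z assume n: "n \<ge> N" "z \<in> spec x"
    have "1 / real (Suc n) \<le> 1 / real (Suc N)" using n by (simp add: frac_le)
    then show "dist (poly (approx_on_spec x f n) z) (f z) < e"
      using a[of n] n N by (fastforce simp: dist_norm)
  qed
qed

lemma poly_at_tendsto_0:
  assumes x: "x \<in> hermitian_elems" and u: "uniform_limit (spec x) (\<lambda>n. poly (p n)) (\<lambda>_. 0) sequentially"
  shows "(\<lambda>n. poly_at x (p n)) \<longlonglongrightarrow> 0"
proof (rule tendstoI)
  fix e :: real assume "e > 0"
  with u have "\<forall>\<^sub>F n in sequentially. \<forall>z\<in>spec x. dist (poly (p n) z) 0 < e"
    by (rule uniform_limitD)
  then show "\<forall>\<^sub>F n in sequentially. dist (poly_at x (p n)) 0 < e"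
  proof eventually_elim
    case (elim n)
    then show ?case using norm_poly_at_attained[OF x, of "p n"] by auto
  qed
qed

lemma Cauchy_poly_at:
  assumes x: "x \<in> hermitian_elems" and u: "uniform_limit (spec x) (\<lambda>n. poly (p n)) f sequentially"
  shows "Cauchy (\<lambda>n. poly_at x (p n))"
proof (rule metric_CauchyI)
  fix e :: real assume "e > 0"
  have "uniformly_Cauchy_on (spec x) (\<lambda>n. poly (p n))"
    using u by (intro uniformly_convergent_Cauchy) (auto simp: uniformly_convergent_on_def)
  then obtain M where M: "\<And>z m n. z \<in> spec x \<Longrightarrow> m \<ge> M \<Longrightarrow> n \<ge> M \<Longrightarrow> dist (poly (p m) z) (poly (p n) z) < e"
    using \<open>e > 0\<close> unfolding uniformly_Cauchy_on_def by metis
  have "dist (poly_at x (p m)) (poly_at x (p n)) < e" if "m \<ge> M" "n \<ge> M" for m n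
    using M that norm_poly_at_attained[OF x, of "p m - p n"]
    by (force simp: dist_norm poly_deriv_at_diff)
  then show "\<exists>M. \<forall>m\<ge>M. \<forall>n\<ge>M. dist (poly_at x (p m)) (poly_at x (p n)) < e" by blast
qed

text \<open>The limit does not depend on the polynomials chosen in \<open>approx_on_spec\<close>;
  the algebraic laws can therefore be checked on sums, products and conjugates of
  approximants.\<close>

lemma func_calc_limit:
  assumes x: "x \<in> hermitian_elems" and f: "continuous_on (spec x) f"
    and u: "uniform_limit (spec x) (\<lambda>n. poly (p n)) f sequentially"
  shows "(\<lambda>n. poly_at x (p n)) \<longlonglongrightarrow> func_calc x f"
proof -
  note v = uniform_limit_approx_on_spec[OF x f]
  have "(\<lambda>n. poly_at x (approx_on_spec x f n)) \<longlonglongrightarrow> func_calc x f"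
    using Cauchy_poly_at[OF x v] unfolding func_calc_def
    by (simp add: Cauchy_convergent convergent_LIMSEQ_iff[symmetric])
  moreover have "(\<lambda>n. poly_at x (p n - approx_on_spec x f n)) \<longlonglongrightarrow> 0"
    by (rule poly_at_tendsto_0[OF x]) (use uniform_limit_minus[OF u v] in \<open>simp add: poly_diff_fun\<close>)
  ultimately show ?thesis
    using tendsto_add by (fastforce simp: poly_deriv_at_diff)
qed

lemma func_calc_poly:
  assumes "x \<in> hermitian_elems"
  shows "func_calc x (poly p) = poly_at x p"
proof -
  have "(\<lambda>n::nat. poly_at x p) \<longlonglongrightarrow> func_calc x (poly p)"
    by (rule func_calc_limit[OF assms]) (simp_all add: continuous_intros uniform_limit_const)
  then show ?thesis by (simp add: LIMSEQ_const_iff)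
qed

text \<open>Existence of a calculus is what makes the choice by SOME in \<open>cfc\<close>
  meaningful.\<close>

lemma is_cfc_func_calc:
  assumes x: "x \<in> hermitian_elems"
  shows "is_cfc x (func_calc x)"
proof -
  let ?C = "continuous_on (spec x)"
  note lim = func_calc_limit[OF x] and apx = uniform_limit_approx_on_spec[OF x]
  note own = lim[OF _ apx]
  have bdd: "bounded (f ` spec x)" if "?C f" for f :: "complex \<Rightarrow> complex"
    by (intro compact_imp_bounded compact_continuous_image compact_spec that)
  have eq: "func_calc x f = func_calc x g \<longleftrightarrow> (\<forall>z\<in>spec x. f z = g z)" if f: "?C f" and g: "?C g" for f g
  proof
    assume e: "func_calc x f = func_calc x g"
    show "\<forall>z\<in>spec x. f z = g z"
    proof
      fix z assume z: "z \<in> spec x"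
      let ?d = "\<lambda>n. approx_on_spec x f n - approx_on_spec x g n"
      have "(\<lambda>n. poly_at x (?d n)) \<longlonglongrightarrow> 0"
        using tendsto_diff[OF own[OF f f] own[OF g g]] e by (simp add: poly_deriv_at_diff)
      \<comment> \<open>Injectivity comes from the lower bound \<open>norm_poly_at_ge\<close>: the
        norm dominates every value on the spectrum.\<close>
      then have "(\<lambda>n. poly (?d n) z) \<longlonglongrightarrow> 0"
        by (rule tendsto_0_le[where K = 1]) (simp add: norm_poly_at_ge[OF z] del: poly_diff)
      moreover have "(\<lambda>n. poly (?d n) z) \<longlonglongrightarrow> f z - g z"
        using tendsto_diff[OF tendsto_uniform_limitI[OF apx[OF f] z] tendsto_uniform_limitI[OF apx[OF g] z]]
        by simp
      ultimately have "f z - g z = 0" by (rule LIMSEQ_unique[symmetric])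
      then show "f z = g z" by simp
    qed
  next
    assume e: "\<forall>z\<in>spec x. f z = g z"
    have "uniform_limit (spec x) (\<lambda>n. poly (approx_on_spec x f n)) g sequentially"
      using apx[OF f] by (rule uniform_limit_cong'[THEN iffD1, rotated -1]) (use e in auto)
    then show "func_calc x f = func_calc x g"
      using LIMSEQ_unique[OF own[OF f f] lim[OF g]] by blast
  qed
  have add: "func_calc x (\<lambda>z. f z + g z) = func_calc x f + func_calc x g" if f: "?C f" and g: "?C g" for f g
  proof -
    have "(\<lambda>n. poly_at x (approx_on_spec x f n + approx_on_spec x g n)) \<longlonglongrightarrow> func_calc x (\<lambda>z. f z + g z)"
      by (intro lim continuous_intros f g) (use uniform_limit_add[OF apx[OF f] apx[OF g]] in \<open>simp add: poly_add_fun\<close>)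
    then show ?thesis
      unfolding poly_deriv_at_add using tendsto_add[OF own[OF f f] own[OF g g]] by (rule LIMSEQ_unique)
  qed
  have mult: "func_calc x (\<lambda>z. f z * g z) = func_calc x f * func_calc x g" if f: "?C f" and g: "?C g" for f g
  proof -
    have "(\<lambda>n. poly_at x (approx_on_spec x f n * approx_on_spec x g n)) \<longlonglongrightarrow> func_calc x (\<lambda>z. f z * g z)"
      by (intro lim continuous_intros f g)
        (use uniform_lim_mult[OF apx[OF f] apx[OF g] bdd[OF f] bdd[OF g]] in \<open>simp add: poly_mult_fun\<close>)
    then show ?thesis
      unfolding poly_at_mult using tendsto_mult[OF own[OF f f] own[OF g g]] by (rule LIMSEQ_unique)
  qed
  have const: "func_calc x (\<lambda>z. c) = scaleC c 1" for c
  proof -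
    have "poly [:c:] = (\<lambda>z. c)" by auto
    then show ?thesis using func_calc_poly[OF x, of "[:c:]"] by (simp add: poly_at_const)
  qed
  have scale: "func_calc x (\<lambda>z. c * f z) = scaleC c (func_calc x f)" if "?C f" for f c
    using mult[of "\<lambda>_. c" f] that by (simp add: const scaleC_mult_left)
  have star: "func_calc x (\<lambda>z. cnj (f z)) = adj (func_calc x f)" if f: "?C f" for f
  proof -
    let ?p = "\<lambda>n. map_poly cnj (approx_on_spec x f n)"
    have "poly (?p n) z = cnj (poly (approx_on_spec x f n) z)" if "z \<in> spec x" for n z
      using poly_map_cnj_real spec_hermitian_real[OF x that] by metis
    then have "uniform_limit (spec x) (\<lambda>n. poly (?p n)) (\<lambda>z. cnj (f z)) sequentially"
      using apx[OF f] by (simp add: uniform_limit_iff dist_norm flip: complex_cnj_diff)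
    then have 1: "(\<lambda>n. poly_at x (?p n)) \<longlonglongrightarrow> func_calc x (\<lambda>z. cnj (f z))"
      using f by (intro lim) (auto intro: continuous_intros)
    have "norm (poly_at x (?p n) - adj (func_calc x f)) = norm (poly_at x (approx_on_spec x f n) - func_calc x f)" for n
    proof -
      have "adj (poly_at x (approx_on_spec x f n)) = adj (poly_at x (approx_on_spec x f n) - func_calc x f) + adj (func_calc x f)"
        unfolding adj_add[symmetric] by simp
      then have "poly_at x (?p n) - adj (func_calc x f) = adj (poly_at x (approx_on_spec x f n) - func_calc x f)"
        by (simp add: adj_poly_at[OF x])
      then show ?thesis by (simp add: norm_adj)
    qed
    then have "(\<lambda>n. poly_at x (?p n)) \<longlonglongrightarrow> adj (func_calc x f)"
      using own[OF f f] unfolding LIMSEQ_iff by simp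
    with 1 show ?thesis by (rule LIMSEQ_unique)
  qed
  have polys: "{\<Sum>i<n. scaleC (c i) (x ^ i) |c n. True} = range (poly_at x)"
  proof (intro equalityI subsetI)
    fix y assume "y \<in> {\<Sum>i<n. scaleC (c i) (x ^ i) |c n. True}"
    then obtain c n where y: "y = (\<Sum>i<n. scaleC (c i) (x ^ i))" by blast
    have "poly_at x (monom c i) = scaleC c (x ^ i)" for c i
      by (induction i) (simp_all add: monom_0 monom_Suc poly_at_const poly_at_pCons scaleC_mult_right)
    then have "y = poly_at x (\<Sum>i<n. monom (c i) i)" by (simp add: y poly_deriv_at_sum)
    then show "y \<in> range (poly_at x)" by blast
  next
    fix y assume "y \<in> range (poly_at x)"
    then obtain p where "y = poly_at x p" by blast
    then have "y = (\<Sum>i<Suc (degree p). scaleC (coeff p i) (x ^ i))"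
      by (simp only: poly_at_altdef lessThan_Suc_atMost)
    then show "y \<in> {\<Sum>i<n. scaleC (c i) (x ^ i) |c n. True}" by blast
  qed
  have range: "func_calc x ` {f. ?C f} = gen_cstar x"
  proof (intro equalityI subsetI)
    fix y assume "y \<in> func_calc x ` {f. ?C f}"
    then obtain f where "?C f" "y = func_calc x f" by blast
    then show "y \<in> gen_cstar x"
      unfolding gen_cstar_def polys closure_sequential
      by (intro exI[of _ "\<lambda>n. poly_at x (approx_on_spec x f n)"]) (auto intro: own)
  next
    fix y assume "y \<in> gen_cstar x"
    then obtain s where s: "\<And>n. s n \<in> range (poly_at x)" "s \<longlonglongrightarrow> y"
      unfolding gen_cstar_def polys closure_sequential by blast
    have "\<forall>n. \<exists>p. s n = poly_at x p" using s(1) by blast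
    then obtain p where p: "\<And>n. s n = poly_at x (p n)" by metis
    \<comment> \<open>The range is closed for the same reason: a sequence of polynomials in
      \<open>x\<close> that is Cauchy in norm is uniformly Cauchy on the spectrum, and the uniform
      limit is the function sought.\<close>
    have "Cauchy s" using s(2) by (rule LIMSEQ_imp_Cauchy)
    have "uniformly_Cauchy_on (spec x) (\<lambda>n. poly (p n))"
    proof (rule uniformly_Cauchy_onI)
      fix e :: real assume "e > 0"
      then obtain M where M: "\<And>m n. m \<ge> M \<Longrightarrow> n \<ge> M \<Longrightarrow> dist (s m) (s n) < e"
        using \<open>Cauchy s\<close> unfolding Cauchy_def by blast
      have "dist (poly (p m) z) (poly (p n) z) < e" if "z \<in> spec x" "m \<ge> M" "n \<ge> M" for z m n
        using norm_poly_at_ge[OF that(1), of "p m - p n"] M[OF that(2,3)]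
        by (simp add: p dist_norm poly_deriv_at_diff)
      then show "\<exists>M. \<forall>z\<in>spec x. \<forall>m\<ge>M. \<forall>n\<ge>M. dist (poly (p m) z) (poly (p n) z) < e" by blast
    qed
    then have "uniformly_convergent_on (spec x) (\<lambda>n. poly (p n))"
      by (rule Cauchy_uniformly_convergent)
    then obtain f where f: "uniform_limit (spec x) (\<lambda>n. poly (p n)) f sequentially"
      by (auto simp: uniformly_convergent_on_def)
    have "?C f"
      by (rule uniform_limit_theorem[OF _ f]) (auto intro!: always_eventually continuous_intros)
    moreover have "s = (\<lambda>n. poly_at x (p n))" using p by auto
    ultimately have "y = func_calc x f" using LIMSEQ_unique[OF s(2)] lim[OF _ f] by metis
    then show "y \<in> func_calc x ` {f. ?C f}" using \<open>?C f\<close> by blast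
  qed
  have id: "func_calc x (\<lambda>z. z) = x"
  proof -
    have "poly [:0, 1:] = (\<lambda>z::complex. z)" by auto
    then show ?thesis using func_calc_poly[OF x, of "[:0, 1:]"] by (simp add: poly_at_pCons scaleC_one)
  qed
  have one: "func_calc x (\<lambda>z. 1) = 1" using const[of 1] by (simp add: scaleC_one)
  show ?thesis
    unfolding is_cfc_def by (intro conjI allI impI eq add mult scale star range id one)
qed

section \<open>Contractivity of an arbitrary functional calculus\<close>

lemma
  assumes "is_cfc x \<Phi>"
  shows is_cfc_cong: "continuous_on (spec x) f \<Longrightarrow> continuous_on (spec x) g \<Longrightarrow>
      (\<And>z. z \<in> spec x \<Longrightarrow> f z = g z) \<Longrightarrow> \<Phi> f = \<Phi> g"
    and is_cfc_add: "continuous_on (spec x) f \<Longrightarrow> continuous_on (spec x) g \<Longrightarrow>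
      \<Phi> (\<lambda>z. f z + g z) = \<Phi> f + \<Phi> g"
    and is_cfc_mult: "continuous_on (spec x) f \<Longrightarrow> continuous_on (spec x) g \<Longrightarrow>
      \<Phi> (\<lambda>z. f z * g z) = \<Phi> f * \<Phi> g"
    and is_cfc_scaleC: "continuous_on (spec x) f \<Longrightarrow> \<Phi> (\<lambda>z. c * f z) = scaleC c (\<Phi> f)"
    and is_cfc_cnj: "continuous_on (spec x) f \<Longrightarrow> \<Phi> (\<lambda>z. cnj (f z)) = adj (\<Phi> f)"
    and is_cfc_1: "\<Phi> (\<lambda>z. 1) = 1"
    and is_cfc_id: "\<Phi> (\<lambda>z. z) = x"
  using assms unfolding is_cfc_def by blast+

lemma is_cfc_const: "is_cfc x \<Phi> \<Longrightarrow> \<Phi> (\<lambda>z. c) = scaleC c 1"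
  using is_cfc_scaleC[of x \<Phi> "\<lambda>_. 1" c] by (simp add: is_cfc_1)

lemma is_cfc_poly:
  assumes "is_cfc x \<Phi>"
  shows "\<Phi> (poly p) = poly_at x p"
proof (induction p)
  case 0
  have "poly 0 = (\<lambda>z::complex. 0)" by auto
  then show ?case using is_cfc_const[OF assms, of 0] by simp
next
  case (pCons a p)
  have "poly (pCons a p) = (\<lambda>z. a + z * poly p z)" by auto
  then have "\<Phi> (poly (pCons a p)) = \<Phi> (\<lambda>z. a) + \<Phi> (\<lambda>z. z * poly p z)"
    using is_cfc_add[OF assms, of "\<lambda>z. a" "\<lambda>z. z * poly p z"] by (simp add: continuous_intros)
  also have "\<Phi> (\<lambda>z. z * poly p z) = x * \<Phi> (poly p)"
    using is_cfc_mult[OF assms, of "\<lambda>z. z" "poly p"] by (simp add: is_cfc_id[OF assms] continuous_intros)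
  finally show ?case by (simp add: is_cfc_const[OF assms] poly_at_pCons pCons.IH)
qed

text \<open>A unital homomorphism does not enlarge the spectrum, so the C*-identity makes it
  contractive; hence every choice made by SOME in cfc agrees with limits of polynomials.\<close>
lemma is_cfc_norm_le:
  assumes \<Phi>: "is_cfc x \<Phi>" and f: "continuous_on (spec x) f"
    and M: "\<And>z. z \<in> spec x \<Longrightarrow> cmod (f z) \<le> M" and M0: "M \<ge> 0"
  shows "norm (\<Phi> f) \<le> M"
proof (rule ccontr)
  assume n: "\<not> ?thesis"
  let ?q = "\<lambda>z. cnj (f z) * f z"
  have q: "continuous_on (spec x) ?q" using f by (intro continuous_intros)
  have "\<Phi> ?q = adj (\<Phi> f) * \<Phi> f"
    using is_cfc_mult[OF \<Phi> continuous_on_cnj[OF f] f] is_cfc_cnj[OF \<Phi> f] by simp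
  then obtain \<nu> where \<nu>: "\<nu> \<in> spec (\<Phi> ?q)" "cmod \<nu> = norm (\<Phi> f) * norm (\<Phi> f)"
    using hermitian_spec_norm_attained[OF hermitian_adj_mult[of "\<Phi> f"]] by (auto simp: cstar_identity)
  have ne: "?q z - \<nu> \<noteq> 0" if "z \<in> spec x" for z
  proof
    assume "?q z - \<nu> = 0"
    then have "cmod \<nu> = cmod (f z) * cmod (f z)" by (auto simp: norm_mult)
    also have "\<dots> \<le> M * M" using M[OF that] M0 by (intro mult_mono) auto
    also have "\<dots> < norm (\<Phi> f) * norm (\<Phi> f)" using n M0 by (intro mult_strict_mono') auto
    finally show False using \<nu>(2) by simp
  qed
  \<comment> \<open>By \<open>ne\<close>, \<open>?r\<close> has a continuous reciprocal on the
    spectrum, whose image under \<Phi> inverts \<open>\<Phi> ?q - scaleC \<nu> 1\<close>; but \<nu>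
    was taken from the spectrum of \<open>\<Phi> ?q\<close>.\<close>
  let ?r = "\<lambda>z. ?q z + (- \<nu>)" and ?i = "\<lambda>z. inverse (?q z + (- \<nu>))"
  have r: "continuous_on (spec x) ?r" using f by (intro continuous_intros)
  have i: "continuous_on (spec x) ?i" using r ne by (intro continuous_on_inverse) auto
  have "\<Phi> ?r = \<Phi> ?q + \<Phi> (\<lambda>z. - \<nu>)"
    using is_cfc_add[OF \<Phi> q continuous_on_const] .
  then have r': "\<Phi> ?r = \<Phi> ?q - scaleC \<nu> 1"
    by (simp add: is_cfc_const[OF \<Phi>] scaleC_minus_left)
  have "\<Phi> (\<lambda>z. ?r z * ?i z) = \<Phi> ?r * \<Phi> ?i" "\<Phi> (\<lambda>z. ?i z * ?r z) = \<Phi> ?i * \<Phi> ?r"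
    using is_cfc_mult[OF \<Phi> r i] is_cfc_mult[OF \<Phi> i r] .
  moreover have "\<Phi> (\<lambda>z. ?r z * ?i z) = \<Phi> (\<lambda>z. 1)"
    by (rule is_cfc_cong[OF \<Phi> continuous_on_mult[OF r i] continuous_on_const]) (use ne in simp)
  moreover have "\<Phi> (\<lambda>z. ?i z * ?r z) = \<Phi> (\<lambda>z. 1)"
    by (rule is_cfc_cong[OF \<Phi> continuous_on_mult[OF i r] continuous_on_const]) (use ne in simp)
  moreover have "\<Phi> (\<lambda>z. 1) = 1" by (rule is_cfc_1[OF \<Phi>])
  ultimately have "is_invertible (\<Phi> ?r)" by (intro is_invertibleI[of _ "\<Phi> ?i" "\<Phi> ?i"]) auto
  then show False using \<nu>(1) unfolding r' spec_iff by simp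
qed

text \<open>This is the only place where the SOME in \<open>cfc\<close> is opened; afterwards
  \<open>cfc\<close> is known only as a limit of polynomials.\<close>

lemma norm_poly_at_minus_cfc_le:
  fixes x :: "'a::cstar_algebra" and g :: "real \<Rightarrow> complex"
  assumes x: "x \<in> hermitian_elems" and g: "continuous_on UNIV g"
    and e: "\<And>t. \<bar>t\<bar> \<le> norm x \<Longrightarrow> cmod (poly p (of_real t) - g t) \<le> e"
  shows "norm (poly_at x p - cfc x g) \<le> e"
proof -
  let ?\<Phi> = "SOME \<Phi>. is_cfc x \<Phi>"
  have \<Phi>: "is_cfc x ?\<Phi>" using is_cfc_func_calc[OF x] by (rule someI[of "is_cfc x"])
  let ?g = "\<lambda>z. g (Re z)"
  have c: "continuous_on (spec x) ?g"
    by (rule continuous_on_compose2[OF g]) (auto intro: continuous_intros)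
  have "?\<Phi> (\<lambda>z. poly p z + (-1) * ?g z) = ?\<Phi> (poly p) + ?\<Phi> (\<lambda>z. (-1) * ?g z)"
    by (rule is_cfc_add[OF \<Phi>]) (intro continuous_intros c)+
  also have "\<dots> = poly_at x p - cfc x g"
    unfolding cfc_def is_cfc_poly[OF \<Phi>] is_cfc_scaleC[OF \<Phi> c] by (simp add: scaleC_minus_left scaleC_one)
  finally have eq: "?\<Phi> (\<lambda>z. poly p z + (-1) * ?g z) = poly_at x p - cfc x g" .
  have le: "cmod (poly p z + (-1) * ?g z) \<le> e" if "z \<in> spec x" for z
  proof -
    have "\<bar>Re z\<bar> \<le> norm x" using spec_norm_le[OF that] abs_Re_le_cmod order_trans by blast
    then have "cmod (poly p (of_real (Re z)) - g (Re z)) \<le> e" by (rule e)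
    then show ?thesis by (simp flip: spec_hermitian_real[OF x that])
  qed
  moreover have "e \<ge> 0" using order_trans[OF norm_ge_zero e[of 0]] by simp
  ultimately show ?thesis
    unfolding eq[symmetric] by (intro is_cfc_norm_le[OF \<Phi>]) (auto intro!: continuous_intros c)
qed

section \<open>Derivatives of polynomials\<close>

lemma del_Cons_0 [simp]: "del 0 (h # hs) = hs"
  and del_Cons_Suc [simp]: "del (Suc i) (h # hs) = h # del i hs"
  by (simp_all add: del_def)

lemma del_update:
  assumes "i < length hs" "j < length hs"
  shows "del j (hs[i := a]) = (if i = j then del j hs else if i < j then (del j hs)[i := a] else (del j hs)[i - 1 := a])"
  using assms
proof (induction hs arbitrary: i j)
  case (Cons h hs)
  then show ?case by (cases i; cases j) (auto split: nat.splits)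
qed simp

lemma norm_del:
  "i < length hs \<Longrightarrow> norm (hs ! i) * (\<Prod>h\<leftarrow>del i hs. norm h) = (\<Prod>h\<leftarrow>hs. norm h)"
proof (induction hs arbitrary: i)
  case (Cons h hs)
  then show ?case by (cases i) (auto simp: mult.left_commute)
qed simp

lemma linear_mult_left: "linear f \<Longrightarrow> linear (\<lambda>a. (c :: 'a::real_normed_algebra) * f a)"
  using linear_compose[of f "(*) c"] bounded_linear_mult_right[of c] bounded_linear.linear
  by (auto simp: o_def)

lemma linear_poly_deriv_at:
  assumes "i < length hs"
  shows "linear (\<lambda>a. poly_deriv_at x p (hs[i := a]))"
  using assms
proof (induction p arbitrary: i hs)
  case 0
  then show ?case by (simp add: linear_zero)
next
  case (pCons c p)
  \<comment> \<open>The varied entry is either the factor pulled out (\<open>i = j\<close>) or it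
    stays in the shortened list, possibly one place earlier, where the induction hypothesis
    applies.\<close>
  have "linear (\<lambda>a. hs[i := a] ! j * poly_deriv_at x p (del j (hs[i := a])))" if j: "j < length hs" for j
  proof (cases "i = j")
    case True
    then show ?thesis
      using pCons.prems bounded_linear.linear[OF bounded_linear_mult_left[of "poly_deriv_at x p (del j hs)"]]
      by (simp add: del_update)
  next
    case False
    then show ?thesis
      using pCons.prems j by (cases "i < j") (auto simp: del_update intro!: linear_mult_left pCons.IH)
  qed
  then have "linear (\<lambda>a. x * poly_deriv_at x p (hs[i := a])
      + (\<Sum>j<length hs. hs[i := a] ! j * poly_deriv_at x p (del j (hs[i := a]))))"
    by (intro linear_compose_add linear_compose_sum linear_mult_left pCons.IH pCons.prems) auto
  moreover have "hs \<noteq> []" using pCons.prems by auto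
  ultimately show ?case by (simp add: poly_deriv_at_pCons)
qed

text \<open>Differentiation along \<open>d\<close> prepends \<open>d\<close> to the directions. In
  the induction the product rule for the leftmost factor \<open>x\<close> yields the summand of
  index 0 in the sum over \<open>d # hs\<close>.\<close>

lemma poly_deriv_at_has_derivative:
  "((\<lambda>t. poly_deriv_at (x + t *\<^sub>R d) p hs) has_vector_derivative
      poly_deriv_at (x + t *\<^sub>R d) p (d # hs)) (at t within S)"
proof (induction p arbitrary: hs)
  case (pCons a p)
  have X: "((\<lambda>t. x + t *\<^sub>R d) has_vector_derivative d) (at t within S)"
    by (auto intro!: derivative_eq_intros)
  have S: "(\<Sum>i<length (d # hs). (d # hs) ! i * poly_deriv_at y p (del i (d # hs)))
     = d * poly_deriv_at y p hs + (\<Sum>i<length hs. hs ! i * poly_deriv_at y p (d # del i hs))" for y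
    by (simp add: sum.lessThan_Suc_shift del: sum.lessThan_Suc)
  have M: "((\<lambda>t. hs ! i * poly_deriv_at (x + t *\<^sub>R d) p (del i hs)) has_vector_derivative
      hs ! i * poly_deriv_at (x + t *\<^sub>R d) p (d # del i hs)) (at t within S)" for i
    by (rule bounded_linear.has_vector_derivative[OF bounded_linear_mult_right pCons.IH])
  show ?case
    unfolding poly_deriv_at_pCons S
    by (rule derivative_eq_intros has_vector_derivative_mult[OF X pCons.IH] has_vector_derivative_sum M refl)+
      (simp add: algebra_simps)
qed simp

section \<open>Chebyshev polynomials\<close>

fun cheb :: "real \<Rightarrow> nat \<Rightarrow> complex poly" where
  "cheb R 0 = 1"
| "cheb R (Suc 0) = smult (of_real (2 / R)) (pCons 0 1)"
| "cheb R (Suc (Suc n)) = smult (of_real (2 / R)) (pCons 0 (cheb R (Suc n))) - cheb R n"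

lemma poly_cheb_Suc_Suc:
  assumes "R \<noteq> 0"
  shows "poly (cheb R (Suc (Suc n))) (of_real (R * cos \<theta>)) =
    of_real (2 * cos \<theta>) * poly (cheb R (Suc n)) (of_real (R * cos \<theta>)) - poly (cheb R n) (of_real (R * cos \<theta>))"
  using assms by simp

text \<open>The classical formula for U_n, multiplied by the sine so that its zeros need no
  exception.\<close>

lemma cheb_sin:
  assumes "R \<noteq> 0"
  shows "poly (cheb R n) (of_real (R * cos \<theta>)) * of_real (sin \<theta>) = of_real (sin (real (Suc n) * \<theta>))"
proof (induction n rule: induct_nat_012)
  case 1
  have "poly (cheb R (Suc 0)) (of_real (R * cos \<theta>)) = of_real (2 * cos \<theta>)" using assms by simp
  moreover have "sin (real (Suc (Suc 0)) * \<theta>) = 2 * cos \<theta> * sin \<theta>"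
    using sin_double[of \<theta>] by simp
  ultimately show ?case by (simp only: of_real_mult)
next
  case (ge2 n)
  have "sin (real (Suc (Suc (Suc n))) * \<theta>) = 2 * cos \<theta> * sin (real (Suc (Suc n)) * \<theta>) - sin (real (Suc n) * \<theta>)"
  proof -
    define a where "a = real (Suc (Suc n)) * \<theta>"
    have "real (Suc (Suc (Suc n))) * \<theta> = a + \<theta>" "real (Suc n) * \<theta> = a - \<theta>"
      by (simp_all add: a_def algebra_simps)
    then show ?thesis unfolding a_def[symmetric] by (simp only: sin_add sin_diff) simp
  qed
  then show ?case
    unfolding poly_cheb_Suc_Suc[OF assms] left_diff_distrib mult.assoc ge2 by simp
qed simp

text \<open>U_(n+1) = cos \<theta> U_n + T_(n+1), with T the polynomials of the first kind. This
  gives |U_n| \<le> n + 1 by induction without a division by \<open>sin \<theta>\<close>.\<close>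

lemma cheb_cos:
  assumes "R \<noteq> 0"
  shows "poly (cheb R (Suc n)) (of_real (R * cos \<theta>)) =
     of_real (cos \<theta>) * poly (cheb R n) (of_real (R * cos \<theta>)) + of_real (cos (real (Suc n) * \<theta>))"
proof (induction n)
  case 0
  then show ?case using assms by simp
next
  case (Suc n)
  let ?v = "poly (cheb R n) (of_real (R * cos \<theta>))"
  have "cos (real (Suc (Suc n)) * \<theta>) = cos \<theta> * cos (real (Suc n) * \<theta>) - sin \<theta> * sin (real (Suc n) * \<theta>)"
  proof -
    define a where "a = real (Suc n) * \<theta>"
    have "real (Suc (Suc n)) * \<theta> = \<theta> + a" by (simp add: a_def algebra_simps)
    then show ?thesis unfolding a_def[symmetric] by (simp only: cos_add)
  qed
  then have 1: "complex_of_real (cos (real (Suc (Suc n)) * \<theta>)) =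
      of_real (cos \<theta>) * of_real (cos (real (Suc n) * \<theta>)) - of_real (sin \<theta>) * (?v * of_real (sin \<theta>))"
    unfolding cheb_sin[OF assms] by (simp flip: of_real_mult of_real_diff)
  have "(of_real (cos \<theta>))\<^sup>2 + (of_real (sin \<theta>))\<^sup>2 = (1::complex)"
    by (metis of_real_1 of_real_add of_real_power sin_cos_squared_add2 power2_eq_square sin_cos_squared_add add.commute)
  then have 2: "of_real (sin \<theta>) * (?v * of_real (sin \<theta>)) = ?v - of_real (cos \<theta>) * (of_real (cos \<theta>) * ?v)"
    by algebra
  show ?case
    unfolding poly_cheb_Suc_Suc[OF assms] 1 2 Suc by (simp add: algebra_simps)
qed

lemma norm_poly_cheb_le:
  assumes R: "R > 0" and t: "\<bar>t\<bar> \<le> R"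
  shows "cmod (poly (cheb R n) (of_real t)) \<le> real (Suc n)"
proof -
  define \<theta> where "\<theta> = arccos (t / R)"
  have "cos \<theta> = t / R" unfolding \<theta>_def using R t by (intro cos_arccos) (auto simp: field_simps)
  then have t': "t = R * cos \<theta>" using R by simp
  have "cmod (poly (cheb R n) (of_real (R * cos \<theta>))) \<le> real (Suc n)"
  proof (induction n)
    case (Suc n)
    have "cmod (poly (cheb R (Suc n)) (of_real (R * cos \<theta>))) \<le>
      \<bar>cos \<theta>\<bar> * cmod (poly (cheb R n) (of_real (R * cos \<theta>))) + \<bar>cos (real (Suc n) * \<theta>)\<bar>"
      using R cheb_cos[of R n \<theta>] norm_triangle_ineq by (metis less_numeral_extra(3) norm_mult norm_of_real)
    also have "\<dots> \<le> 1 * real (Suc n) + 1"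
      using Suc by (intro add_mono mult_mono) (auto simp: abs_cos_le_one)
    finally show ?case by simp
  qed simp
  then show ?thesis by (simp add: t')
qed

lemma norm_poly_at_cheb_le:
  assumes "x \<in> hermitian_elems" "norm x \<le> R" "R > 0"
  shows "norm (poly_at x (cheb R n)) \<le> real (Suc n)"
  using assms by (intro norm_poly_at_le norm_poly_cheb_le) auto

text \<open>A discrete Duhamel formula: \<open>U\<close> is the fundamental solution, and the source
  \<open>f j\<close> is propagated through the remaining steps by \<open>U (n - 1 - j)\<close>. All
  coefficients act from the left, which suits a noncommutative ring.\<close>

lemma recurrence_solution:
  fixes U w f :: "nat \<Rightarrow> 'a::ring_1"
  assumes U: "U 0 = 1" "U (Suc 0) = c" "\<And>n. U (Suc (Suc n)) = c * U (Suc n) - U n"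
    and w: "w 0 = 0" "w (Suc 0) = f 0" "\<And>n. w (Suc (Suc n)) = c * w (Suc n) - w n + f (Suc n)"
  shows "w n = (\<Sum>j<n. U (n - 1 - j) * f j)"
proof (induction n rule: induct_nat_012)
  case (ge2 n)
  \<comment> \<open>The summands \<open>j = n\<close> and \<open>j = Suc n\<close> are treated
    separately, since there the recurrence for \<open>U\<close> would reach a negative
    index.\<close>
  have "U (Suc n - j) * f j = c * (U (n - j) * f j) - U (n - 1 - j) * f j" if "j < n" for j
  proof -
    obtain k where k: "n - j = Suc k" using \<open>j < n\<close> not0_implies_Suc[of "n - j"] by auto
    then have "Suc n - j = Suc (Suc k)" "n - 1 - j = k" using \<open>j < n\<close> by auto
    then show ?thesis unfolding k by (simp add: U(3) algebra_simps)
  qed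
  then have "(\<Sum>j<n. U (Suc n - j) * f j) = c * (\<Sum>j<n. U (n - j) * f j) - (\<Sum>j<n. U (n - 1 - j) * f j)"
    by (simp add: sum_subtractf sum_distrib_left)
  then show ?case
    using ge2 by (simp add: w(3) U(1,2) algebra_simps)
qed (simp_all add: U w)

text \<open>\<open>poly_deriv_at_pCons\<close> splits the differentiated recurrence into the same
  recurrence, with left multiplication by (2/R) x, and a source in which one direction has been used
  up. As \<open>hs\<close> is nonempty, the initial value is a derivative of the constant 1 and
  vanishes.\<close>

lemma poly_deriv_at_cheb:
  assumes "hs \<noteq> []"
  shows "poly_deriv_at x (cheb R n) hs = (\<Sum>j<n. poly_at x (cheb R (n - 1 - j)) *
      scaleC (of_real (2 / R)) (\<Sum>i<length hs. hs ! i * poly_deriv_at x (cheb R j) (del i hs)))"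
proof (rule recurrence_solution[where U = "\<lambda>n. poly_at x (cheb R n)" and w = "\<lambda>n. poly_deriv_at x (cheb R n) hs"
      and c = "scaleC (of_real (2 / R)) x"])
  show 0: "poly_deriv_at x (cheb R 0) hs = 0"
    using assms by (simp add: one_pCons poly_deriv_at_pCons)
  show "poly_deriv_at x (cheb R (Suc 0)) hs = scaleC (of_real (2 / R))
      (\<Sum>i<length hs. hs ! i * poly_deriv_at x (cheb R 0) (del i hs))"
    using assms 0 unfolding cheb.simps poly_deriv_at_smult poly_deriv_at_pCons[of x 0 1] by simp
  show "poly_at x (cheb R (Suc 0)) = scaleC (of_real (2 / R)) x"
    unfolding cheb.simps poly_deriv_at_smult poly_deriv_at_pCons[of x 0 1] by (simp add: poly_at_1)
qed (use assms in \<open>simp_all only: cheb.simps poly_at_1 poly_deriv_at_smult poly_deriv_at_diff poly_deriv_at_pCons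
      scaleC_mult_left scaleC_add_right\<close>, simp_all)

text \<open>Each derivative costs a factor \<open>2 / R\<close>, the number of directions still
  available, and (n+1)^2: at most n summands, each with a value V_(n-1-j)(x) of norm at most n + 1.
  The last factor n + 1 bounds V_n(x) itself.\<close>

lemma norm_poly_deriv_at_cheb_le:
  assumes x: "x \<in> hermitian_elems" "norm x \<le> R" and R: "R > 0"
  shows "norm (poly_deriv_at x (cheb R n) hs)
    \<le> (2 / R) ^ length hs * fact (length hs) * real (Suc n) ^ (2 * length hs + 1) * (\<Prod>h\<leftarrow>hs. norm h)"
proof (induction "length hs" arbitrary: hs n)
  case 0
  then show ?case using norm_poly_at_cheb_le[OF x R] by simp
next
  case (Suc k)
  let ?P = "\<Prod>h\<leftarrow>hs. norm h" and ?N = "real (Suc n)"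
  let ?B = "(2 / R) ^ k * fact k * ?N ^ (2 * k + 1)"
  have P0: "?P \<ge> 0" by (intro prod_list_nonneg) auto
  have len: "length hs = Suc k" using Suc.hyps(2) by simp
  have 1: "norm (hs ! i * poly_deriv_at x (cheb R j) (del i hs)) \<le> ?B * ?P" if "i < length hs" "j < n" for i j
  proof -
    let ?Q = "\<Prod>h\<leftarrow>del i hs. norm h"
    have Q0: "?Q \<ge> 0" by (intro prod_list_nonneg) auto
    have "norm (poly_deriv_at x (cheb R j) (del i hs)) \<le> (2 / R) ^ k * fact k * real (Suc j) ^ (2 * k + 1) * ?Q"
      using Suc.hyps(1)[of "del i hs" j] that len by simp
    also have "\<dots> \<le> ?B * ?Q"
      using that R Q0 by (intro mult_right_mono mult_left_mono power_mono) auto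
    finally have "norm (poly_deriv_at x (cheb R j) (del i hs)) \<le> ?B * ?Q" .
    then have "norm (hs ! i) * norm (poly_deriv_at x (cheb R j) (del i hs)) \<le> norm (hs ! i) * (?B * ?Q)"
      by (intro mult_left_mono) auto
    also have "\<dots> = ?B * ?P" using norm_del[OF that(1)] by (simp add: mult.left_commute)
    finally show ?thesis using norm_mult_ineq order_trans by blast
  qed
  have 2: "norm (scaleC (of_real (2 / R)) (\<Sum>i<length hs. hs ! i * poly_deriv_at x (cheb R j) (del i hs)))
      \<le> (2 / R) * (real (Suc k) * (?B * ?P))" if "j < n" for j
  proof -
    have "norm (\<Sum>i<length hs. hs ! i * poly_deriv_at x (cheb R j) (del i hs)) \<le> real (card {..<length hs}) * (?B * ?P)"
      by (intro sum_norm_bound 1 that) simp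
    then show ?thesis using R by (simp add: norm_scaleC norm_divide len divide_right_mono)
  qed
  have 3: "norm (poly_at x (cheb R (n - 1 - j)) *
      scaleC (of_real (2 / R)) (\<Sum>i<length hs. hs ! i * poly_deriv_at x (cheb R j) (del i hs)))
      \<le> ?N * ((2 / R) * (real (Suc k) * (?B * ?P)))" if j: "j < n" for j
  proof -
    have "norm (poly_at x (cheb R (n - 1 - j))) \<le> ?N"
      using norm_poly_at_cheb_le[OF x R, of "n - 1 - j"] by simp
    from mult_mono[OF this 2[OF j]] show ?thesis using norm_mult_ineq order_trans by fastforce
  qed
  have "hs \<noteq> []" using len by auto
  have "norm (poly_deriv_at x (cheb R n) hs) \<le> real (card {..<n}) * (?N * ((2 / R) * (real (Suc k) * (?B * ?P))))"
    unfolding poly_deriv_at_cheb[OF \<open>hs \<noteq> []\<close>] by (intro sum_norm_bound 3) simp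
  also have "\<dots> \<le> ?N * (?N * ((2 / R) * (real (Suc k) * (?B * ?P))))"
    using R P0 by (intro mult_right_mono) auto
  also have "\<dots> = (2 / R) ^ Suc k * fact (Suc k) * ?N ^ (2 * Suc k + 1) * ?P"
  proof -
    have "N * (N * (c * (s * (c ^ k * F * N ^ (2 * k + 1) * P)))) = c ^ Suc k * (s * F) * N ^ (2 * Suc k + 1) * P"
      for N c s F P :: real by (simp add: mult_ac)
    then show ?thesis unfolding fact_Suc .
  qed
  finally show ?case by (simp only: len)
qed

section \<open>Decay of Chebyshev coefficients\<close>

definition cheb_op :: "real \<Rightarrow> complex poly \<Rightarrow> complex poly" where
  "cheb_op R p = [:0, 1:] * ([:0, 1:] * pderiv (pderiv p)) - smult (of_real (R\<^sup>2)) (pderiv (pderiv p))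
     + smult 3 ([:0, 1:] * pderiv p) + p"

text \<open>The differential equation is derived algebraically from the two first-order relations
  \<open>CD\<close> between neighbours.\<close>

lemma cheb_op_cheb:
  assumes "R \<noteq> 0"
  shows "cheb_op R (cheb R n) = smult (of_nat ((Suc n)\<^sup>2)) (cheb R n)"
proof -
  \<comment> \<open>The constant R is made a polynomial so that all relations live in one
    commutative ring, where they can be combined by ideal membership.\<close>
  define X K :: "complex poly" where "X = [:0, 1:]" and "K = [:of_real R:]"
  have dX: "pderiv X = 1" and dK: "pderiv K = 0" by (simp_all add: X_def K_def pderiv_pCons)
  have K0: "K \<noteq> 0" using assms by (simp add: K_def)
  have dN: "pderiv (of_nat n :: complex poly) = 0" for n by (simp add: of_nat_poly pderiv_pCons)
  define v where "v = cheb R"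
  let ?d = "\<lambda>n. pderiv (v n)"
  have v0: "v 0 = 1" by (simp add: v_def)
  have rec1: "K * v (Suc 0) = 2 * X"
    using assms by (simp add: v_def K_def X_def numeral_poly)
  have rec: "K * v (Suc (Suc n)) = 2 * X * v (Suc n) - K * v n" for n
    using assms by (simp add: v_def K_def X_def numeral_poly smult_diff_right)
  have drec: "K * ?d (Suc (Suc n)) = 2 * v (Suc n) + 2 * X * ?d (Suc n) - K * ?d n" for n
  proof -
    have "pderiv (K * v (Suc (Suc n))) = pderiv (2 * (X * v (Suc n)) - K * v n)"
      unfolding rec by (simp add: mult.assoc)
    then show ?thesis
      unfolding pderiv_diff pderiv_mult dX dK by (simp add: pderiv_numeral algebra_simps)
  qed
  have CD: "X * ?d (Suc n) = K * ?d n + of_nat (Suc n) * v (Suc n) \<and>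
      K * ?d (Suc n) = X * ?d n + of_nat (Suc (Suc n)) * v n" for n
  proof (induction n)
    case 0
    have "pderiv (K * v (Suc 0)) = pderiv (2 * X)" unfolding rec1 ..
    then have 1: "K * ?d (Suc 0) = 2" unfolding pderiv_mult dX dK by (simp add: pderiv_numeral)
    then have "K * (X * ?d (Suc 0)) = K * v (Suc 0)" unfolding rec1 by (simp add: mult.left_commute)
    then show ?case using 1 K0 v0 by simp
  next
    case (Suc n)
    have D: "K * ?d (Suc (Suc n)) = X * ?d (Suc n) + of_nat (Suc (Suc (Suc n))) * v (Suc n)"
      using drec[of n] Suc unfolding of_nat_Suc by algebra
    \<comment> \<open>The recurrences are available only after multiplication by \<open>K\<close>,
      which is cancelled at the end.\<close>
    have "K * (X * ?d (Suc (Suc n))) = K * (K * ?d (Suc n) + of_nat (Suc (Suc n)) * v (Suc (Suc n)))"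
      using D drec[of n] Suc rec[of n] unfolding of_nat_Suc by algebra
    then show ?case using D K0 by simp
  qed
  let ?e = "\<lambda>n. pderiv (?d n)"
  \<comment> \<open>Differentiating \<open>X\<close> yields one more first derivative: it lowers the
    coefficient n + 1 of \<open>CD\<close> to n here, and raises n + 2 to n + 3 in
    \<open>D'\<close>.\<close>
  have C': "X * ?e (Suc n) = K * ?e n + of_nat n * ?d (Suc n)"
  proof -
    have "pderiv (X * ?d (Suc n)) = pderiv (K * ?d n + of_nat (Suc n) * v (Suc n))" using CD by simp
    then show ?thesis unfolding pderiv_mult pderiv_add dX dK dN by (simp add: algebra_simps)
  qed
  have D': "K * ?e (Suc n) = X * ?e n + of_nat (n + 3) * ?d n"
  proof -
    have "pderiv (K * ?d (Suc n)) = pderiv (X * ?d n + of_nat (Suc (Suc n)) * v n)" using CD by simp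
    then show ?thesis unfolding pderiv_mult pderiv_add dX dK dN by (simp add: algebra_simps)
  qed
  \<comment> \<open>X times \<open>D'\<close> and K times \<open>C'\<close> eliminate the second
    derivative of V_(n+1); the second half of \<open>CD\<close> then eliminates its first
    derivative.\<close>
  have "X * (X * ?e n) - K * K * ?e n + 3 * (X * ?d n) + v n = (of_nat n + 1) * (of_nat n + 1) * v n"
    using C' D' CD[of n] unfolding of_nat_Suc of_nat_add of_nat_numeral by algebra
  moreover have "K * K * ?e n = smult (of_real (R\<^sup>2)) (?e n)"
    by (simp add: K_def power2_eq_square)
  moreover have "3 * (X * ?d n) = smult 3 (X * ?d n)" by (simp add: numeral_poly)
  moreover have "(of_nat n + 1) * (of_nat n + 1) * v n = smult (of_nat ((Suc n)\<^sup>2)) (v n)"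
    by (simp add: of_nat_poly power2_eq_square one_pCons algebra_simps)
  ultimately show ?thesis unfolding cheb_op_def X_def v_def by simp
qed

section \<open>Orthogonality and Chebyshev expansion\<close>

lemma has_integral_cos_nat:
  "((\<lambda>\<theta>. cos (real k * \<theta>)) has_integral (if k = 0 then pi else 0)) {0..pi}"
proof (cases "k = 0")
  case True
  then show ?thesis using has_integral_const_real[of "1::real" 0 pi] by simp
next
  case False
  have "((\<lambda>\<theta>. cos (real k * \<theta>)) has_integral (sin (real k * pi) / real k - sin (real k * 0) / real k)) {0..pi}"
    by (rule fundamental_theorem_of_calculus)
      (use False in \<open>auto intro!: derivative_eq_intros simp flip: has_real_derivative_iff_has_vector_derivative\<close>)
  then show ?thesis using False by simp
qed

lemma has_integral_sin_sin:
  "((\<lambda>\<theta>. sin (real (Suc m) * \<theta>) * sin (real (Suc n) * \<theta>)) has_integral (if m = n then pi / 2 else 0)) {0..pi}"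
proof -
  \<comment> \<open>\<open>max m n - min m n\<close> is |m - n| as a natural number, the form of
    frequency that \<open>has_integral_cos_nat\<close> takes.\<close>
  have "((\<lambda>\<theta>. 1/2 * (cos (real (max m n - min m n) * \<theta>) - cos (real (m + n + 2) * \<theta>)))
      has_integral (1/2 * ((if max m n - min m n = 0 then pi else 0) - (if m + n + 2 = 0 then pi else 0)))) {0..pi}"
    by (intro has_integral_mult_right has_integral_diff has_integral_cos_nat)
  moreover have "1/2 * (cos (real (max m n - min m n) * \<theta>) - cos (real (m + n + 2) * \<theta>)) =
      sin (real (Suc m) * \<theta>) * sin (real (Suc n) * \<theta>)" for \<theta>
  proof -
    have "cos (real (max m n - min m n) * \<theta>) = cos (real (Suc m) * \<theta> - real (Suc n) * \<theta>)"
    proof (cases "m \<le> n")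
      case True
      have "real (max m n - min m n) * \<theta> = - (real (Suc m) * \<theta> - real (Suc n) * \<theta>)"
        using True by (simp add: max_def min_def of_nat_diff algebra_simps)
      then show ?thesis by (simp only: cos_minus)
    next
      case False
      have "real (max m n - min m n) * \<theta> = real (Suc m) * \<theta> - real (Suc n) * \<theta>"
        using False by (simp add: max_def min_def of_nat_diff algebra_simps)
      then show ?thesis by simp
    qed
    moreover have "real (m + n + 2) * \<theta> = real (Suc m) * \<theta> + real (Suc n) * \<theta>"
      by (simp add: algebra_simps)
    ultimately show ?thesis by (simp only: cos_diff cos_add) simp
  qed
  moreover have "max m n - min m n = 0 \<longleftrightarrow> m = n" by auto
  ultimately show ?thesis by (simp split: if_splits)
qed

text \<open>At t = R cos \<theta> one sine turns V_n into sin((n+1)\<theta>), and orthogonality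
  isolates \<open>a m\<close> times pi/2. The integrand is at most \<open>M\<close> on an interval
  of length pi, whence the factor 2.\<close>

lemma cheb_coeff_le:
  assumes R: "R > 0" and p: "p = (\<Sum>n<N. smult (a n) (cheb R n))"
    and M: "\<And>t. \<bar>t\<bar> \<le> R \<Longrightarrow> cmod (poly p (of_real t)) \<le> M" and m: "m < N"
  shows "cmod (a m) \<le> 2 * M"
proof -
  let ?s = "\<lambda>k \<theta>. sin (real (Suc k) * \<theta>)"
  let ?f = "\<lambda>\<theta>. poly p (of_real (R * cos \<theta>)) * of_real (sin \<theta>) * of_real (?s m \<theta>)"
  have f: "?f \<theta> = (\<Sum>n<N. a n * of_real (?s n \<theta> * ?s m \<theta>))" for \<theta>
  proof -
    define z where "z = complex_of_real (R * cos \<theta>)"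
    have "poly p z * of_real (sin \<theta>) * of_real (?s m \<theta>)
        = (\<Sum>n<N. a n * ((poly (cheb R n) z * of_real (sin \<theta>)) * of_real (?s m \<theta>)))"
      by (simp only: p poly_sum poly_smult sum_distrib_right mult.assoc)
    moreover have "poly (cheb R n) z * of_real (sin \<theta>) = of_real (?s n \<theta>)" for n
      unfolding z_def by (rule cheb_sin) (use R in simp)
    ultimately show ?thesis by (simp only: of_real_mult z_def)
  qed
  have "(?f has_integral (\<Sum>n<N. a n * of_real (if n = m then pi / 2 else 0))) {0..pi}"
    unfolding f by (intro has_integral_sum has_integral_mult_right has_integral_of_real has_integral_sin_sin) simp
  moreover have "(\<Sum>n<N. a n * of_real (if n = m then pi / 2 else 0)) = a m * of_real (pi / 2)"
    using m by (subst sum.remove[of _ m]) auto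
  ultimately have I: "(?f has_integral (a m * of_real (pi / 2))) (cbox 0 pi)" by (simp add: cbox_interval)
  have M0: "0 \<le> M" using order_trans[OF norm_ge_zero M[of 0]] R by simp
  have "norm (a m * of_real (pi / 2)) \<le> M * measure lborel (cbox 0 pi)"
  proof (rule has_integral_bound[OF M0 I])
    fix \<theta> :: real assume "\<theta> \<in> cbox 0 pi"
    have "\<bar>R * cos \<theta>\<bar> \<le> R" using R abs_cos_le_one[of \<theta>] by (simp add: abs_mult mult_left_le)
    then have "norm (?f \<theta>) \<le> M * 1 * 1"
      unfolding norm_mult norm_of_real by (intro mult_mono M) (auto simp: M0 simp del: of_real_mult)
    then show "norm (?f \<theta>) \<le> M" by simp
  qed
  then show ?thesis by (simp add: norm_mult field_simps)
qed

lemma smult_sum_distrib: "smult c (\<Sum>i\<in>I. f i) = (\<Sum>i\<in>I. smult c (f i))"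
  by (induction I rule: infinite_finite_induct) (auto simp: smult_add_right)

text \<open>The span of the V_n contains 1 and is stable under multiplication by X, because the
  recurrence reads X V_n = (R/2)(V_(n+1) + V_(n-1)).\<close>

lemma cheb_expansion:
  assumes R: "R \<noteq> 0"
  shows "\<exists>N a. p = (\<Sum>n<N. smult (a n) (cheb R n))"
proof -
  define E where "E = (\<lambda>p. \<exists>N a. p = (\<Sum>n<(N::nat). smult (a n) (cheb R n)))"
  have add: "E (p + q)" if "E p" "E q" for p q
  proof -
    obtain N a N' a' where pq: "p = (\<Sum>n<N. smult (a n) (cheb R n))" "q = (\<Sum>n<N'. smult (a' n) (cheb R n))"
      using \<open>E p\<close> \<open>E q\<close> unfolding E_def by blast
    \<comment> \<open>Both expansions are padded with zeros to a common length.\<close>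
    have ext: "(\<Sum>n<L. smult (b n) (cheb R n)) = (\<Sum>n<N + N'. smult (if n < L then b n else 0) (cheb R n))"
      if "L \<le> N + N'" for L and b :: "nat \<Rightarrow> complex"
      using that by (intro sum.mono_neutral_cong_left) auto
    have "p + q = (\<Sum>n<N + N'. smult ((if n < N then a n else 0) + (if n < N' then a' n else 0)) (cheb R n))"
      unfolding pq by (subst (1 2) ext) (simp_all add: smult_add_left sum.distrib)
    then show ?thesis unfolding E_def
      by (intro exI[of _ "N + N'"] exI[of _ "\<lambda>n. (if n < N then a n else 0) + (if n < N' then a' n else 0)"])
  qed
  have smult: "E (smult c p)" if "E p" for c p
  proof -
    obtain N a where "p = (\<Sum>n<N. smult (a n) (cheb R n))" using \<open>E p\<close> unfolding E_def by blast
    then have "smult c p = (\<Sum>n<N. smult (c * a n) (cheb R n))"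
      by (simp add: smult_sum_distrib)
    then show ?thesis unfolding E_def by (intro exI[of _ N] exI[of _ "\<lambda>n. c * a n"])
  qed
  have "E 0" unfolding E_def by (intro exI[of _ 0]) simp
  have cheb: "E (cheb R n)" for n
  proof -
    have "cheb R n = (\<Sum>k<Suc n. smult (if k = n then 1 else 0) (cheb R k))"
      by (subst sum.remove[of _ n]) auto
    then show ?thesis unfolding E_def by (intro exI[of _ "Suc n"] exI[of _ "\<lambda>k. if k = n then 1 else 0"])
  qed
  have X: "E (pCons 0 (cheb R n))" for n
  proof (cases n)
    case 0
    then have "pCons 0 (cheb R n) = smult (of_real (R / 2)) (cheb R (Suc 0))" using R by simp
    then show ?thesis using smult cheb by metis
  next
    case (Suc k)
    then have "pCons 0 (cheb R n) = smult (of_real (R / 2)) (cheb R (Suc n) + cheb R k)"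
      using R by simp
    then show ?thesis using smult add cheb by metis
  qed
  have "E p"
  proof (induction p)
    case (pCons c p)
    obtain N a where p: "p = (\<Sum>n<N. smult (a n) (cheb R n))" using pCons.IH unfolding E_def by blast
    have "E (\<Sum>n<K. smult (a n) (pCons 0 (cheb R n)))" for K
    proof (induction K)
      case 0
      show ?case using \<open>E 0\<close> by simp
    next
      case (Suc K)
      show ?case unfolding sum.lessThan_Suc by (intro add Suc.IH smult X)
    qed
    moreover have "pCons 0 p = (\<Sum>n<N. smult (a n) (pCons 0 (cheb R n)))"
    proof -
      have "pCons 0 p = [:0, 1:] * p" by simp
      also have "\<dots> = (\<Sum>n<N. smult (a n) ([:0, 1:] * cheb R n))"
        unfolding p by (simp only: sum_distrib_left mult_smult_right)
      finally show ?thesis by simp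
    qed
    ultimately have "E (pCons 0 p)" by simp
    moreover have "E [:c:]" using smult[OF cheb[of 0], of c] by simp
    ultimately show ?case using add[of "[:c:]" "pCons 0 p"] by simp
  qed fact
  then show ?thesis unfolding E_def .
qed

section \<open>Seminorms of derivatives on an interval\<close>

text \<open>A relation in place of a seminorm, so that no supremum has to be formed.\<close>

definition derivs_le :: "real \<Rightarrow> nat \<Rightarrow> complex poly \<Rightarrow> real \<Rightarrow> bool" where
  "derivs_le R N p M \<longleftrightarrow> (\<forall>i\<le>N. \<forall>t. \<bar>t\<bar> \<le> R \<longrightarrow> cmod (poly ((pderiv ^^ i) p) (of_real t)) \<le> M)"

text \<open>Continuity for the topology of uniform convergence of all derivatives on $[-R, R]$.\<close>
definition tame_op :: "real \<Rightarrow> (complex poly \<Rightarrow> complex poly) \<Rightarrow> bool" where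
  "tame_op R T \<longleftrightarrow> (\<forall>j. \<exists>N C. C \<ge> 0 \<and> (\<forall>p M. derivs_le R N p M \<longrightarrow> derivs_le R j (T p) (C * M)))"

lemma derivs_le_mono: "derivs_le R N p M \<Longrightarrow> N' \<le> N \<Longrightarrow> M \<le> M' \<Longrightarrow> derivs_le R N' p M'"
  unfolding derivs_le_def by (meson order_trans)

lemma derivs_le_nonneg: "derivs_le R N p M \<Longrightarrow> R \<ge> 0 \<Longrightarrow> M \<ge> 0"
  unfolding derivs_le_def by (metis abs_zero norm_ge_zero order_trans zero_le)

lemma pderiv_iterate_add: "(pderiv ^^ i) (p + q) = (pderiv ^^ i) p + (pderiv ^^ i) q"
  and pderiv_iterate_diff: "(pderiv ^^ i) (p - q) = (pderiv ^^ i) p - (pderiv ^^ i) q"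
  and pderiv_iterate_smult: "(pderiv ^^ i) (smult c p) = smult c ((pderiv ^^ i) p)"
  for p q :: "complex poly"
  by (induction i) (simp_all add: pderiv_add pderiv_diff pderiv_smult)

text \<open>Leibniz' rule. At \<open>i = 0\<close> the truncated \<open>i - 1\<close> does no harm,
  as its coefficient is 0.\<close>

lemma pderiv_iterate_X_mult:
  "(pderiv ^^ i) ([:0, 1:] * p) = [:0, 1:] * (pderiv ^^ i) p + smult (of_nat i) ((pderiv ^^ (i - 1)) p)"
  for p :: "complex poly"
proof (induction i)
  case (Suc i)
  have X: "pderiv [:0, 1:] = (1 :: complex poly)" by (simp add: pderiv_pCons)
  have "smult (of_nat i) (pderiv ((pderiv ^^ (i - 1)) p)) = smult (of_nat i) ((pderiv ^^ i) p)"
    by (cases i) auto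
  moreover have "(pderiv ^^ Suc i) ([:0, 1:] * p) =
      [:0, 1:] * pderiv ((pderiv ^^ i) p) + (pderiv ^^ i) p + smult (of_nat i) (pderiv ((pderiv ^^ (i - 1)) p))"
    unfolding funpow.simps o_apply Suc pderiv_add pderiv_mult X pderiv_smult by (simp add: mult.commute)
  ultimately show ?case by (simp add: smult_add_left)
qed simp

lemma tame_op_id: "tame_op R (\<lambda>p. p)"
  unfolding tame_op_def by (metis mult_1 zero_le_one)

lemma tame_op_comp:
  assumes "tame_op R S" "tame_op R T"
  shows "tame_op R (\<lambda>p. S (T p))"
  unfolding tame_op_def
proof
  fix j
  obtain N C where 1: "C \<ge> 0" "\<And>p M. derivs_le R N p M \<Longrightarrow> derivs_le R j (S p) (C * M)"
    using assms(1) unfolding tame_op_def by blast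
  obtain N' C' where 2: "C' \<ge> 0" "\<And>p M. derivs_le R N' p M \<Longrightarrow> derivs_le R N (T p) (C' * M)"
    using assms(2) unfolding tame_op_def by blast
  show "\<exists>N C. C \<ge> 0 \<and> (\<forall>p M. derivs_le R N p M \<longrightarrow> derivs_le R j (S (T p)) (C * M))"
    by (intro exI[of _ N'] exI[of _ "C * C'"]) (use 1 2 in \<open>simp add: mult.assoc\<close>)
qed

lemma tame_op_add:
  assumes "tame_op R S" "tame_op R T"
  shows "tame_op R (\<lambda>p. S p + T p)"
  unfolding tame_op_def
proof
  fix j
  obtain N C where 1: "C \<ge> 0" "\<And>p M. derivs_le R N p M \<Longrightarrow> derivs_le R j (S p) (C * M)"
    using assms(1) unfolding tame_op_def by blast
  obtain N' C' where 2: "C' \<ge> 0" "\<And>p M. derivs_le R N' p M \<Longrightarrow> derivs_le R j (T p) (C' * M)"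
    using assms(2) unfolding tame_op_def by blast
  have "derivs_le R j (S p + T p) ((C + C') * M)" if "derivs_le R (max N N') p M" for p M
  proof -
    have "derivs_le R j (S p) (C * M)" "derivs_le R j (T p) (C' * M)"
      using that by (auto intro!: 1 2 elim: derivs_le_mono)
    then show ?thesis
      unfolding derivs_le_def pderiv_iterate_add poly_add distrib_right by (blast intro: norm_triangle_mono)
  qed
  then show "\<exists>N C. C \<ge> 0 \<and> (\<forall>p M. derivs_le R N p M \<longrightarrow> derivs_le R j (S p + T p) (C * M))"
    using 1(1) 2(1) by (intro exI[of _ "max N N'"] exI[of _ "C + C'"]) auto
qed

lemma tame_op_smult: "tame_op R (\<lambda>p. smult c p)"
  unfolding tame_op_def
proof
  fix j
  show "\<exists>N C. C \<ge> 0 \<and> (\<forall>p M. derivs_le R N p M \<longrightarrow> derivs_le R j (smult c p) (C * M))"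
    by (intro exI[of _ j] exI[of _ "cmod c"])
      (auto simp: derivs_le_def pderiv_iterate_smult norm_mult intro!: mult_left_mono)
qed

lemma tame_op_pderiv: "tame_op R pderiv"
  unfolding tame_op_def
proof
  fix j
  have "derivs_le R j (pderiv p) M" if "derivs_le R (Suc j) p M" for p M
    unfolding derivs_le_def
  proof (intro allI impI)
    fix i and t :: real assume "i \<le> j" "\<bar>t\<bar> \<le> R"
    then have "cmod (poly ((pderiv ^^ Suc i) p) (of_real t)) \<le> M"
      using that unfolding derivs_le_def by (metis Suc_le_mono)
    then show "cmod (poly ((pderiv ^^ i) (pderiv p)) (of_real t)) \<le> M"
      by (simp only: funpow_Suc_right o_apply)
  qed
  then show "\<exists>N C. C \<ge> 0 \<and> (\<forall>p M. derivs_le R N p M \<longrightarrow> derivs_le R j (pderiv p) (C * M))"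
    by (intro exI[of _ "Suc j"] exI[of _ 1]) auto
qed

lemma tame_op_X_mult:
  assumes R: "R \<ge> 0"
  shows "tame_op R (\<lambda>p. [:0, 1:] * p)"
  unfolding tame_op_def
proof
  fix j
  have "derivs_le R j ([:0, 1:] * p) ((R + real j) * M)" if p: "derivs_le R j p M" for p M
    unfolding derivs_le_def
  proof (intro allI impI)
    fix i and t :: real assume i: "i \<le> j" and t: "\<bar>t\<bar> \<le> R"
    have M: "cmod (poly ((pderiv ^^ k) p) (of_real t)) \<le> M" if "k \<le> j" for k
      using p that t unfolding derivs_le_def by blast
    have M0: "M \<ge> 0" using derivs_le_nonneg[OF p R] .
    have "\<bar>t\<bar> * cmod (poly ((pderiv ^^ i) p) (of_real t)) \<le> R * M"
      using t R by (intro mult_mono M i) auto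
    moreover have "real i * cmod (poly ((pderiv ^^ (i - 1)) p) (of_real t)) \<le> real j * M"
      using i by (intro mult_mono M) auto
    ultimately show "cmod (poly ((pderiv ^^ i) ([:0, 1:] * p)) (of_real t)) \<le> (R + real j) * M"
      unfolding pderiv_iterate_X_mult poly_add distrib_right
      by (intro norm_triangle_mono) (simp_all add: norm_mult)
  qed
  then show "\<exists>N C. C \<ge> 0 \<and> (\<forall>p M. derivs_le R N p M \<longrightarrow> derivs_le R j ([:0, 1:] * p) (C * M))"
    using R by (intro exI[of _ j] exI[of _ "R + real j"]) auto
qed

lemma tame_op_cheb_op:
  assumes R: "R \<ge> 0"
  shows "tame_op R (cheb_op R)"
proof -
  note X = tame_op_X_mult[OF R]
  note D = tame_op_pderiv[of R] and D2 = tame_op_comp[OF tame_op_pderiv[of R] tame_op_pderiv]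
  note C = tame_op_comp[OF tame_op_smult[of R]]
  have "tame_op R (\<lambda>p. [:0, 1:] * ([:0, 1:] * pderiv (pderiv p)) + smult (- of_real (R\<^sup>2)) (pderiv (pderiv p))
     + smult 3 ([:0, 1:] * pderiv p) + p)"
    by (rule tame_op_add[OF tame_op_add[OF tame_op_add[OF tame_op_comp[OF X tame_op_comp[OF X D2]]
      C[OF D2]] C[OF tame_op_comp[OF X D]]] tame_op_id])
  then show ?thesis unfolding cheb_op_def[abs_def] by simp
qed

lemma tame_op_funpow: "tame_op R T \<Longrightarrow> tame_op R (T ^^ m)"
proof (induction m)
  case 0
  then show ?case using tame_op_id by (simp add: id_def)
next
  case (Suc m)
  then show ?case using tame_op_comp by (simp add: o_def)
qed

lemma cheb_op_sum:
  assumes "R \<noteq> 0"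
  shows "(cheb_op R ^^ m) (\<Sum>n<N. smult (a n) (cheb R n))
    = (\<Sum>n<N. smult (a n * of_nat ((Suc n) ^ (2 * m))) (cheb R n))"
proof (induction m)
  case (Suc m)
  have add: "cheb_op R (p + q) = cheb_op R p + cheb_op R q" for p q
    by (simp add: cheb_op_def pderiv_add algebra_simps smult_add_right)
  have smult: "cheb_op R (smult c p) = smult c (cheb_op R p)" for c p
    by (simp add: cheb_op_def pderiv_smult algebra_simps smult_add_right smult_diff_right)
  have sum: "cheb_op R (\<Sum>n<K. f n) = (\<Sum>n<K. cheb_op R (f n))" for K :: nat and f
    by (induction K) (auto simp: add, simp add: cheb_op_def)
  show ?case
    by (simp only: funpow.simps o_apply Suc sum smult cheb_op_cheb[OF assms] smult_smult mult.assoc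
        flip: of_nat_mult power_add) (simp add: power2_eq_square mult_ac)
qed simp

section \<open>The a priori estimate\<close>

text \<open>\<open>N\<close> and \<open>C\<close> precede \<open>p\<close>, \<open>x\<close> and
  \<open>hs\<close>. This uniformity lets the estimate be applied to differences of approximating
  polynomials and along whole segments.\<close>

lemma norm_poly_deriv_at_le:
  assumes R: "R > 0"
  shows "\<exists>N C. C \<ge> 0 \<and> (\<forall>p M x hs. derivs_le R N p M \<longrightarrow> x \<in> hermitian_elems \<longrightarrow> norm x \<le> R \<longrightarrow>
    length hs = k \<longrightarrow> norm (poly_deriv_at (x::'a::cstar_algebra) p hs) \<le> C * M * (\<Prod>h\<leftarrow>hs. norm h))"
proof -
  \<comment> \<open>The coefficients will decay like (n+1)^(-2m), the derivatives grow like
    (n+1)^(2k+1); m = k + 2 leaves at least the summable factor (n+1)^(-2).\<close>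
  define m where "m = k + 2"
  have R0: "R \<noteq> 0" "R \<ge> 0" using R by auto
  obtain N C where C: "C \<ge> 0" "\<And>p M. derivs_le R N p M \<Longrightarrow> derivs_le R 0 ((cheb_op R ^^ m) p) (C * M)"
    using tame_op_funpow[OF tame_op_cheb_op[OF R0(2)], of m] unfolding tame_op_def by blast
  define B where "B = (2 / R) ^ k * fact k"
  define Z where "Z = (\<Sum>n. inverse (real (Suc n) ^ 2))"
  have B0: "B \<ge> 0" using R by (simp add: B_def)
  have sZ: "summable (\<lambda>n. inverse (real (Suc n) ^ 2))"
    using inverse_power_summable[of 2, where 'a = real] by (subst summable_Suc_iff) simp
  have Z0: "Z \<ge> 0" unfolding Z_def by (intro suminf_nonneg sZ) simp
  have "norm (poly_deriv_at x p hs) \<le> (2 * C * B * Z) * M * (\<Prod>h\<leftarrow>hs. norm h)"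
    if p: "derivs_le R N p M" and x: "x \<in> hermitian_elems" "norm x \<le> R" and len: "length hs = k"
    for p M and x :: 'a and hs
  proof -
    let ?P = "\<Prod>h\<leftarrow>hs. norm h"
    have P0: "?P \<ge> 0" by (intro prod_list_nonneg) auto
    have M0: "M \<ge> 0" by (rule derivs_le_nonneg[OF p R0(2)])
    obtain L a where a: "p = (\<Sum>n<L. smult (a n) (cheb R n))" using cheb_expansion[OF R0(1)] by blast
    \<comment> \<open>\<open>(cheb_op R ^^ m) p\<close> has the coefficients a_n (n+1)^(2m), and
      \<open>C * M\<close> bounds it on the interval.\<close>
    have co: "cmod (a n) * real (Suc n) ^ (2 * m) \<le> 2 * (C * M)" if "n < L" for n
    proof -
      have "cmod (a n * of_nat ((Suc n) ^ (2 * m))) \<le> 2 * (C * M)"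
        using C(2)[OF p] that unfolding a cheb_op_sum[OF R0(1)]
        by (intro cheb_coeff_le[OF R refl]) (auto simp: derivs_le_def)
      then show ?thesis by (simp only: norm_mult norm_of_nat of_nat_power norm_power)
    qed
    have summand: "norm (scaleC (a n) (poly_deriv_at x (cheb R n) hs)) \<le> (2 * C * B * M * ?P) * inverse (real (Suc n) ^ 2)"
      if n: "n < L" for n
    proof -
      let ?n = "real (Suc n)"
      have "norm (poly_deriv_at x (cheb R n) hs) \<le> B * ?n ^ (2 * k + 1) * ?P"
        using norm_poly_deriv_at_cheb_le[OF x R, of n hs] by (simp add: B_def len)
      also have "\<dots> \<le> B * ?n ^ (2 * k + 2) * ?P"
        by (intro mult_right_mono mult_left_mono power_increasing) (use B0 P0 in auto)
      also have "?n ^ (2 * k + 2) = ?n ^ (2 * m) * inverse (?n ^ 2)"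
        by (simp add: m_def power_add power2_eq_square field_simps del: of_nat_Suc)
      finally have "norm (poly_deriv_at x (cheb R n) hs) \<le> B * (?n ^ (2 * m) * inverse (?n ^ 2)) * ?P" .
      then have "cmod (a n) * norm (poly_deriv_at x (cheb R n) hs)
          \<le> cmod (a n) * (B * (?n ^ (2 * m) * inverse (?n ^ 2)) * ?P)"
        by (rule mult_left_mono) simp
      also have "\<dots> = (cmod (a n) * ?n ^ (2 * m)) * (B * inverse (?n ^ 2) * ?P)" by (simp only: mult_ac)
      also have "\<dots> \<le> (2 * (C * M)) * (B * inverse (?n ^ 2) * ?P)"
        by (intro mult_right_mono co n mult_nonneg_nonneg B0 P0) simp
      finally show ?thesis by (simp only: norm_scaleC mult_ac)
    qed
    have "norm (poly_deriv_at x p hs) \<le> (\<Sum>n<L. (2 * C * B * M * ?P) * inverse (real (Suc n) ^ 2))"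
      unfolding a poly_deriv_at_sum poly_deriv_at_smult by (intro sum_norm_le summand) simp
    also have "\<dots> = (2 * C * B * M * ?P) * (\<Sum>n<L. inverse (real (Suc n) ^ 2))"
      by (simp only: sum_distrib_left)
    also have "\<dots> \<le> (2 * C * B * M * ?P) * Z"
      unfolding Z_def by (intro mult_left_mono sum_le_suminf sZ mult_nonneg_nonneg) (use C(1) B0 M0 P0 in auto)
    finally show ?thesis by (simp only: mult_ac)
  qed
  then show ?thesis
    using C(1) B0 Z0 by (intro exI[of _ N] exI[of _ "2 * C * B * Z"]) auto
qed

section \<open>Passage to the limit\<close>

lemma mean_value_bound:
  fixes f :: "real \<Rightarrow> 'b::real_normed_vector"
  assumes f: "\<And>t. t \<in> {a..b} \<Longrightarrow> (f has_vector_derivative f' t) (at t within {a..b})"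
    and B: "\<And>t. t \<in> {a..b} \<Longrightarrow> norm (f' t) \<le> B" and st: "s \<in> {a..b}" "t \<in> {a..b}"
  shows "norm (f s - f t) \<le> B * \<bar>s - t\<bar>"
proof -
  have "norm (f s - f t) \<le> B * norm (s - t)"
  proof (rule differentiable_bound[where S = "{a..b}" and f' = "\<lambda>t h. h *\<^sub>R f' t"])
    show "(f has_derivative (\<lambda>h. h *\<^sub>R f' u)) (at u within {a..b})" if "u \<in> {a..b}" for u
      using f[OF that] by (simp add: has_vector_derivative_def)
    show "onorm (\<lambda>h. h *\<^sub>R f' u) \<le> B" if "u \<in> {a..b}" for u
      by (rule onorm_le) (use B[OF that] in \<open>simp add: mult.commute[of B] mult_left_mono\<close>)
  qed (use st in auto)
  then show ?thesis by simp
qed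

text \<open>The mean value inequality is used twice along the segment, first for the derivative,
  then for the remainder; the usual factor 1/2 is given up. The smallness in \<open>y - x\<close> is
  contained in \<open>B\<close>, since \<open>y - x\<close> occurs twice among the
  directions.\<close>

lemma poly_deriv_at_taylor:
  fixes x y :: "'a::cstar_algebra"
  assumes B: "\<And>t. t \<in> {0..1} \<Longrightarrow> norm (poly_deriv_at (x + t *\<^sub>R (y - x)) p ((y - x) # (y - x) # hs)) \<le> B"
  shows "norm (poly_deriv_at y p hs - poly_deriv_at x p hs - poly_deriv_at x p ((y - x) # hs)) \<le> B"
proof -
  let ?f = "\<lambda>hs t. poly_deriv_at (x + t *\<^sub>R (y - x)) p hs"
  have B0: "0 \<le> B" using order_trans[OF norm_ge_zero B[of 0]] by simp
  have 1: "norm (?f ((y - x) # hs) t - ?f ((y - x) # hs) 0) \<le> B" if t: "t \<in> {0..1}" for t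
  proof -
    have "norm (?f ((y - x) # hs) t - ?f ((y - x) # hs) 0) \<le> B * \<bar>t - 0\<bar>"
      by (rule mean_value_bound[OF poly_deriv_at_has_derivative B t]) auto
    also have "\<dots> \<le> B" using t B0 by (simp add: mult_left_le)
    finally show ?thesis .
  qed
  have "norm (?f hs 1 - ?f hs 0 - (1 - 0) *\<^sub>R ?f ((y - x) # hs) 0) \<le> norm (1 - 0 :: real) * B"
    by (rule vector_differentiable_bound_linearization[of "{0..1}", OF poly_deriv_at_has_derivative _ 1])
      (auto simp: closed_segment_eq_real_ivl)
  then show ?thesis by simp
qed

section \<open>Polynomial approximation of smooth functions\<close>

lemma poly_antiderivative: "\<exists>P. pderiv P = (q :: complex poly)"
proof -
  have sum: "pderiv (\<Sum>i\<in>I. f i) = (\<Sum>i\<in>I. pderiv (f i))" for I :: "nat set" and f :: "nat \<Rightarrow> complex poly"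
    by (induction I rule: infinite_finite_induct) (auto simp: pderiv_add)
  have "pderiv (\<Sum>i\<le>degree q. monom (coeff q i / of_nat (Suc i)) (Suc i)) = (\<Sum>i\<le>degree q. monom (coeff q i) i)"
    unfolding sum pderiv_monom by (simp del: of_nat_Suc)
  then show ?thesis using poly_as_sum_of_monoms by metis
qed

lemma poly_has_vector_derivative:
  "((\<lambda>t. poly p (of_real t)) has_vector_derivative poly (pderiv p) (complex_of_real t)) (at t within S)"
  by (rule has_vector_derivative_real_field) (rule poly_DERIV)

text \<open>Approximating \<open>g\<close> itself says nothing about derivatives. So Weierstrass is
  applied to the highest derivative, and the approximation is integrated back.\<close>

lemma smooth_poly_approx:
  fixes G :: "nat \<Rightarrow> real \<Rightarrow> complex"
  assumes G: "\<And>k t. (G k has_vector_derivative G (Suc k) t) (at t)" and R: "R \<ge> 0" and e: "e > 0"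
  shows "\<exists>p. \<forall>i\<le>N. \<forall>t. \<bar>t\<bar> \<le> R \<longrightarrow> cmod (poly ((pderiv ^^ i) p) (of_real t) - G i t) \<le> e"
  using G e
proof (induction N arbitrary: G e)
  case 0
  have "continuous_on {-R..R} (G 0)"
    using 0(1) has_vector_derivative_continuous by (intro continuous_at_imp_continuous_on) blast
  then obtain p where "\<forall>t\<in>{-R..R}. cmod (poly p (of_real t) - G 0 t) < e"
    using weierstrass_complex_poly[of "{-R..R}" "G 0" e] 0(2) by auto
  then show ?case by (intro exI[of _ p]) (auto simp: abs_le_iff intro!: less_imp_le)
next
  case (Suc N)
  \<comment> \<open>Integration from 0 multiplies the error by at most \<open>R\<close>; the choice
    yields both \<open>d \<le> e\<close> for the derivatives and \<open>d * R \<le> e\<close> for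
    the antiderivative.\<close>
  define d where "d = e / (R + 1)"
  have d: "d > 0" "d \<le> e" "d * R \<le> e"
    using R Suc.prems(2) by (auto simp: d_def field_simps)
  obtain q where q: "\<And>i t. i \<le> N \<Longrightarrow> \<bar>t\<bar> \<le> R \<Longrightarrow> cmod (poly ((pderiv ^^ i) q) (of_real t) - G (Suc i) t) \<le> d"
    using Suc.IH[of "\<lambda>k. G (Suc k)" d] Suc.prems(1) d(1) by blast
  obtain P where P: "pderiv P = q" using poly_antiderivative by blast
  \<comment> \<open>The constant of integration makes the error vanish at 0.\<close>
  define p where "p = P + [:G 0 0 - poly P 0:]"
  have p: "pderiv p = q" by (simp add: p_def pderiv_add P pderiv_pCons)
  have "cmod (poly p (of_real t) - G 0 t) \<le> e" if t: "\<bar>t\<bar> \<le> R" for t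
  proof -
    let ?f = "\<lambda>t. poly p (complex_of_real t) - G 0 t"
    have "norm (?f t - ?f 0) \<le> d * \<bar>t - 0\<bar>"
    proof (rule mean_value_bound[where a = "-R" and b = R and f' = "\<lambda>t. poly q (of_real t) - G (Suc 0) t"])
      show "(?f has_vector_derivative poly q (complex_of_real u) - G (Suc 0) u) (at u within {-R..R})" for u
        unfolding p[symmetric]
        by (intro has_vector_derivative_diff poly_has_vector_derivative
            has_vector_derivative_at_within[OF Suc.prems(1)])
      show "cmod (poly q (complex_of_real u) - G (Suc 0) u) \<le> d" if "u \<in> {-R..R}" for u
        using q[of 0 u] that by (simp add: abs_le_iff)
    qed (use t R in auto)
    also have "\<dots> \<le> d * R" using t d(1) by simp
    finally show ?thesis using d(3) by (simp add: p_def)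
  qed
  moreover have "cmod (poly ((pderiv ^^ Suc i) p) (of_real t) - G (Suc i) t) \<le> e" if "i \<le> N" "\<bar>t\<bar> \<le> R" for i t
    using q[OF that] d(2) by (simp only: funpow_Suc_right o_apply p)
  ultimately show ?case
    by (intro exI[of _ p] allI impI) (metis Suc_le_mono funpow_0 not0_implies_Suc)
qed

text \<open>A diagonal choice: the index \<open>n\<close> governs the number of derivatives, the
  radius and the error at once, so one sequence serves all \<open>N\<close> and
  \<open>R\<close>.\<close>

lemma smooth_poly_sequence:
  fixes G :: "nat \<Rightarrow> real \<Rightarrow> complex"
  assumes G: "\<And>k t. (G k has_vector_derivative G (Suc k) t) (at t)"
  shows "\<exists>p. \<forall>n i t. i \<le> n \<longrightarrow> \<bar>t\<bar> \<le> real n \<longrightarrow>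
     cmod (poly ((pderiv ^^ i) (p n)) (of_real t) - G i t) \<le> inverse (real (Suc n))"
proof -
  have "\<forall>n. \<exists>p. \<forall>i\<le>n. \<forall>t. \<bar>t\<bar> \<le> real n \<longrightarrow>
     cmod (poly ((pderiv ^^ i) p) (of_real t) - G i t) \<le> inverse (real (Suc n))"
    by (intro allI smooth_poly_approx G) auto
  then show ?thesis by metis
qed

lemma smooth_derivs_bounded:
  fixes G :: "nat \<Rightarrow> real \<Rightarrow> complex"
  assumes G: "\<And>k t. (G k has_vector_derivative G (Suc k) t) (at t)"
  shows "\<exists>M. \<forall>i\<le>N. \<forall>t. \<bar>t\<bar> \<le> R \<longrightarrow> cmod (G i t) \<le> M"
proof -
  have "\<forall>i. \<exists>M. \<forall>t\<in>{-R..R}. cmod (G i t) \<le> M"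
  proof
    fix i
    have "continuous_on {-R..R} (G i)"
      using G has_vector_derivative_continuous by (intro continuous_at_imp_continuous_on) blast
    then have "bounded (G i ` {-R..R})" by (intro compact_imp_bounded compact_continuous_image) auto
    then show "\<exists>M. \<forall>t\<in>{-R..R}. cmod (G i t) \<le> M" by (auto simp: bounded_iff)
  qed
  then obtain M where M: "\<And>i t. t \<in> {-R..R} \<Longrightarrow> cmod (G i t) \<le> M i" by metis
  have "cmod (G i t) \<le> Max (M ` {..N})" if "i \<le> N" "\<bar>t\<bar> \<le> R" for i t
    using M[of t i] that by (intro order_trans[OF _ Max_ge[of _ "M i"]]) (auto simp: abs_le_iff)
  then show ?thesis by blast
qed

section \<open>Derivatives as limits of polynomial derivatives\<close>

locale smooth_approximation =
  fixes G :: "nat \<Rightarrow> real \<Rightarrow> complex" and p :: "nat \<Rightarrow> complex poly"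
  assumes G: "(G k has_vector_derivative G (Suc k) t) (at t)"
    and p: "i \<le> n \<Longrightarrow> \<bar>t\<bar> \<le> real n \<Longrightarrow>
      cmod (poly ((pderiv ^^ i) (p n)) (of_real t) - G i t) \<le> inverse (real (Suc n))"
begin

lemma derivs_le_diff:
  assumes "N \<le> m" "N \<le> n" "R \<le> real m" "R \<le> real n"
  shows "derivs_le R N (p m - p n) (inverse (real (Suc m)) + inverse (real (Suc n)))"
  unfolding derivs_le_def pderiv_iterate_diff poly_diff
proof (intro allI impI)
  fix i t assume "i \<le> N" "\<bar>t\<bar> \<le> R"
  then have "cmod (poly ((pderiv ^^ i) (p m)) (of_real t) - G i t) \<le> inverse (real (Suc m))"
    "cmod (poly ((pderiv ^^ i) (p n)) (of_real t) - G i t) \<le> inverse (real (Suc n))"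
    using assms by (auto intro!: p simp del: of_nat_Suc)
  then show "cmod (poly ((pderiv ^^ i) (p m)) (of_real t) - poly ((pderiv ^^ i) (p n)) (of_real t))
      \<le> inverse (real (Suc m)) + inverse (real (Suc n))"
    by norm
qed

lemma derivs_le_eventually: "\<exists>M\<ge>0. \<forall>\<^sub>F n in sequentially. derivs_le R N (p n) M"
proof -
  obtain M where M: "\<And>i t. i \<le> N \<Longrightarrow> \<bar>t\<bar> \<le> R \<Longrightarrow> cmod (G i t) \<le> M"
    using smooth_derivs_bounded[of G N R] G by blast
  have "derivs_le R N (p n) (\<bar>M\<bar> + 1)" if n: "n \<ge> max N (nat \<lceil>R\<rceil>)" for n
    unfolding derivs_le_def
  proof (intro allI impI)
    fix i t assume i: "i \<le> N" and t: "\<bar>t\<bar> \<le> R"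
    have "R \<le> real n" using n by linarith
    then have "cmod (poly ((pderiv ^^ i) (p n)) (of_real t) - G i t) \<le> inverse (real (Suc n))"
      using n i t by (intro p) auto
    moreover have "inverse (real (Suc n)) \<le> 1" by (simp add: field_simps)
    ultimately show "cmod (poly ((pderiv ^^ i) (p n)) (of_real t)) \<le> \<bar>M\<bar> + 1"
      using M[OF i t] norm_triangle_sub[of "poly ((pderiv ^^ i) (p n)) (of_real t)" "G i t"] by linarith
  qed
  then show ?thesis
    unfolding eventually_sequentially
    by (intro exI[of _ "\<bar>M\<bar> + 1"] conjI exI[of _ "max N (nat \<lceil>R\<rceil>)"] allI impI) auto
qed

text \<open>The candidate for the derivatives of all orders; the order is the length of the
  list.\<close>

definition deriv_at :: "'a::cstar_algebra \<Rightarrow> 'a list \<Rightarrow> 'a" where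
  "deriv_at x hs = lim (\<lambda>n. poly_deriv_at x (p n) hs)"

lemma deriv_at_limit:
  assumes x: "x \<in> hermitian_elems"
  shows "(\<lambda>n. poly_deriv_at x (p n) hs) \<longlonglongrightarrow> deriv_at x hs"
proof -
  define R where "R = norm x + 1"
  have R: "R > 0" "norm x \<le> R" by (auto simp: R_def add_nonneg_pos)
  obtain N C where C: "C \<ge> 0" "\<And>q M. derivs_le R N q M \<Longrightarrow>
      norm (poly_deriv_at x q hs) \<le> C * M * (\<Prod>h\<leftarrow>hs. norm h)"
    using norm_poly_deriv_at_le[OF R(1), where k = "length hs" and 'a = 'a] x R(2) by blast
  let ?P = "\<Prod>h\<leftarrow>hs. norm h"
  have P0: "?P \<ge> 0" by (intro prod_list_nonneg) auto
  have "Cauchy (\<lambda>n. poly_deriv_at x (p n) hs)"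
  proof (rule CauchyI')
    fix e :: real assume "e > 0"
    \<comment> \<open>The 2 accounts for the two errors of \<open>p m\<close> and
      \<open>p n\<close>; the summand 1 keeps the denominator positive when \<open>C\<close> or a
      direction vanishes.\<close>
    then obtain K where K: "inverse (real (Suc K)) < e / (2 * (C * ?P + 1))"
      using reals_Archimedean[of "e / (2 * (C * ?P + 1))"] C(1) P0 by (auto simp: add_nonneg_pos)
    define L where "L = max K (max N (nat \<lceil>R\<rceil>))"
    have "norm (poly_deriv_at x (p m) hs - poly_deriv_at x (p n) hs) < e" if "m \<ge> L" "n > m" for m n
    proof -
      have "derivs_le R N (p m - p n) (inverse (real (Suc m)) + inverse (real (Suc n)))"
        using that unfolding L_def by (intro derivs_le_diff) linarith+
      moreover have "inverse (real (Suc m)) \<le> inverse (real (Suc K))" "inverse (real (Suc n)) \<le> inverse (real (Suc K))"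
        using that unfolding L_def by (auto intro!: le_imp_inverse_le)
      ultimately have "derivs_le R N (p m - p n) (2 * inverse (real (Suc K)))"
        by (elim derivs_le_mono) linarith+
      then have "norm (poly_deriv_at x (p m - p n) hs) \<le> C * (2 * inverse (real (Suc K))) * ?P" by (rule C(2))
      also have "\<dots> = (C * ?P) * (2 * inverse (real (Suc K)))" by (simp only: mult_ac)
      also have "\<dots> \<le> (C * ?P + 1) * (2 * inverse (real (Suc K)))" by (intro mult_right_mono) auto
      also have "\<dots> < (C * ?P + 1) * (2 * (e / (2 * (C * ?P + 1))))"
        using K C(1) P0 by (intro mult_strict_left_mono) (auto simp: add_nonneg_pos)
      also have "\<dots> = e"
      proof -
        have "c * (2 * (e / (2 * c))) = e" if "c > 0" for c :: real using that by simp
        moreover have "C * ?P + 1 > 0" using C(1) P0 by (intro add_nonneg_pos mult_nonneg_nonneg) auto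
        ultimately show ?thesis .
      qed
      finally show ?thesis by (simp add: poly_deriv_at_diff)
    qed
    then show "\<exists>L. \<forall>m\<ge>L. \<forall>n>m. dist (poly_deriv_at x (p m) hs) (poly_deriv_at x (p n) hs) < e"
      unfolding dist_norm by blast
  qed
  then show ?thesis
    unfolding deriv_at_def by (simp add: Cauchy_convergent convergent_LIMSEQ_iff[symmetric])
qed

lemma deriv_at_Nil:
  fixes x :: "'a::cstar_algebra"
  assumes x: "x \<in> hermitian_elems"
  shows "deriv_at x [] = cfc x (G 0)"
proof -
  have c: "continuous_on UNIV (G 0)"
    using G has_vector_derivative_continuous by (intro continuous_at_imp_continuous_on) blast
  have "norm (poly_at x (p n) - cfc x (G 0)) \<le> inverse (real (Suc n))" if "n \<ge> nat \<lceil>norm x\<rceil>" for n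
    by (rule norm_poly_at_minus_cfc_le[OF x c]) (use that p[of 0 n] in auto)
  then have "\<forall>\<^sub>F n in sequentially. norm (poly_at x (p n) - cfc x (G 0)) \<le> inverse (real (Suc n))"
    unfolding eventually_sequentially by blast
  then have "(\<lambda>n. poly_at x (p n) - cfc x (G 0)) \<longlonglongrightarrow> 0"
    by (rule Lim_null_comparison[OF _ LIMSEQ_inverse_real_of_nat])
  then have "(\<lambda>n. poly_at x (p n)) \<longlonglongrightarrow> cfc x (G 0)" by (simp add: LIM_zero_iff)
  then show ?thesis using LIMSEQ_unique[OF deriv_at_limit[OF x]] by blast
qed

lemma linear_deriv_at:
  assumes x: "x \<in> hermitian_elems" and i: "i < length hs"
  shows "linear (\<lambda>a. deriv_at x (hs[i := a]))"
proof (rule linearI)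
  note lin = linear_poly_deriv_at[OF i, of x] and lim = deriv_at_limit[OF x]
  fix a b :: 'a and r :: real
  show "deriv_at x (hs[i := a + b]) = deriv_at x (hs[i := a]) + deriv_at x (hs[i := b])"
    using lim[of "hs[i := a + b]"] tendsto_add[OF lim[of "hs[i := a]"] lim[of "hs[i := b]"]]
    unfolding linear_add[OF lin] by (rule LIMSEQ_unique)
  show "deriv_at x (hs[i := r *\<^sub>R a]) = r *\<^sub>R deriv_at x (hs[i := a])"
    using lim[of "hs[i := r *\<^sub>R a]"] tendsto_scaleR[OF tendsto_const lim[of "hs[i := a]"], of r]
    unfolding linear_scale[OF lin] by (rule LIMSEQ_unique)
qed

lemma deriv_at_bound:
  assumes "R > 0"
  shows "\<exists>C\<ge>0. \<forall>(x::'a::cstar_algebra)\<in>hermitian_elems. norm x \<le> R \<longrightarrow>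
    (\<forall>hs. length hs = k \<longrightarrow> norm (deriv_at x hs) \<le> C * (\<Prod>h\<leftarrow>hs. norm h))"
proof -
  obtain N C where C: "C \<ge> 0" "\<And>q M (x::'a) hs. derivs_le R N q M \<Longrightarrow> x \<in> hermitian_elems \<Longrightarrow>
      norm x \<le> R \<Longrightarrow> length hs = k \<Longrightarrow> norm (poly_deriv_at x q hs) \<le> C * M * (\<Prod>h\<leftarrow>hs. norm h)"
    using norm_poly_deriv_at_le[OF assms, where k = k and 'a = 'a] by blast
  obtain M where M: "M \<ge> 0" "\<forall>\<^sub>F n in sequentially. derivs_le R N (p n) M"
    using derivs_le_eventually by blast
  have "norm (deriv_at x hs) \<le> C * M * (\<Prod>h\<leftarrow>hs. norm h)"
    if "x \<in> hermitian_elems" "norm x \<le> R" "length hs = k" for x :: 'a and hs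
    by (rule Lim_norm_ubound[OF _ deriv_at_limit[OF that(1)]])
      (use M(2) in \<open>auto elim!: eventually_mono intro!: C(2) that\<close>)
  then show ?thesis using C(1) M(1) by (intro exI[of _ "C * M"]) auto
qed

text \<open>Differentiability does not survive pointwise limits, but a remainder bound with a
  constant independent of n does. The estimate for k + 2 directions supplies it, and the two
  directions \<open>y - x\<close> give the square.\<close>

lemma deriv_at_taylor:
  assumes "R > 0"
  shows "\<exists>C\<ge>0. \<forall>(x::'a::cstar_algebra)\<in>hermitian_elems. \<forall>y\<in>hermitian_elems. norm x \<le> R \<longrightarrow> norm y \<le> R \<longrightarrow>
    (\<forall>hs. length hs = k \<longrightarrow> norm (deriv_at y hs - deriv_at x hs - deriv_at x ((y - x) # hs))
      \<le> C * (norm (y - x))\<^sup>2 * (\<Prod>h\<leftarrow>hs. norm h))"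
proof -
  obtain N C where C: "C \<ge> 0" "\<And>q M (x::'a) hs. derivs_le R N q M \<Longrightarrow> x \<in> hermitian_elems \<Longrightarrow>
      norm x \<le> R \<Longrightarrow> length hs = k + 2 \<Longrightarrow> norm (poly_deriv_at x q hs) \<le> C * M * (\<Prod>h\<leftarrow>hs. norm h)"
    using norm_poly_deriv_at_le[OF assms, where k = "k + 2" and 'a = 'a] by blast
  obtain M where M: "M \<ge> 0" "\<forall>\<^sub>F n in sequentially. derivs_le R N (p n) M"
    using derivs_le_eventually by blast
  have "norm (deriv_at y hs - deriv_at x hs - deriv_at x ((y - x) # hs))
      \<le> C * M * (norm (y - x))\<^sup>2 * (\<Prod>h\<leftarrow>hs. norm h)"
    if x: "x \<in> hermitian_elems" "norm x \<le> R" and y: "y \<in> hermitian_elems" "norm y \<le> R" and len: "length hs = k"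
    for x y :: 'a and hs
  proof (rule Lim_norm_ubound)
    show "(\<lambda>n. poly_deriv_at y (p n) hs - poly_deriv_at x (p n) hs - poly_deriv_at x (p n) ((y - x) # hs))
        \<longlonglongrightarrow> deriv_at y hs - deriv_at x hs - deriv_at x ((y - x) # hs)"
      by (intro tendsto_diff deriv_at_limit x y)
    \<comment> \<open>The Hermitian elements and the ball are convex, so the a priori estimate is
      available on the whole segment.\<close>
    have seg: "x + t *\<^sub>R (y - x) \<in> hermitian_elems" "norm (x + t *\<^sub>R (y - x)) \<le> R" if t: "t \<in> {0..1}" for t
    proof -
      show "x + t *\<^sub>R (y - x) \<in> hermitian_elems" using x y by (intro hermitian_add hermitian_scaleR hermitian_diff)
      have "(1 - t) *\<^sub>R x + t *\<^sub>R y \<in> cball 0 R"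
        using x y t by (intro convexD_alt[OF convex_cball]) auto
      then show "norm (x + t *\<^sub>R (y - x)) \<le> R" by (simp add: algebra_simps)
    qed
    show "\<forall>\<^sub>F n in sequentially. norm (poly_deriv_at y (p n) hs - poly_deriv_at x (p n) hs
        - poly_deriv_at x (p n) ((y - x) # hs)) \<le> C * M * (norm (y - x))\<^sup>2 * (\<Prod>h\<leftarrow>hs. norm h)"
      using M(2)
    proof eventually_elim
      case (elim n)
      have "norm (poly_deriv_at (x + t *\<^sub>R (y - x)) (p n) ((y - x) # (y - x) # hs))
          \<le> C * M * (norm (y - x))\<^sup>2 * (\<Prod>h\<leftarrow>hs. norm h)" if "t \<in> {0..1}" for t
        using C(2)[OF elim seg[OF that], of "(y - x) # (y - x) # hs"] len
        by (simp add: power2_eq_square mult.assoc)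
      then show ?case by (rule poly_deriv_at_taylor)
    qed
  qed simp
  then show ?thesis using C(1) M(1) by (intro exI[of _ "C * M"]) auto
qed

lemma BC_infty_cfc: "BC_infty (hermitian_elems :: 'a::cstar_algebra set) (\<lambda>x. cfc x (G 0))"
proof -
  let ?S = "hermitian_elems :: 'a set"
  let ?P = "\<lambda>hs::'a list. \<Prod>h\<leftarrow>hs. norm h"
  have P0: "?P hs \<ge> 0" for hs by (intro prod_list_nonneg) auto
  have near: "norm y \<le> norm x + 1" if "norm (y - x) < 1" for x y :: 'a
    using norm_triangle_sub[of y x] that by linarith
  have pos: "norm x + 1 > 0" for x :: 'a by (simp add: add_nonneg_pos)
  have D0: "deriv_at x [] = cfc x (G 0)" if "x \<in> ?S" for x :: 'a
    using that by (rule deriv_at_Nil)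
  have lin: "deriv_at x (hs[i := a + b]) = deriv_at x (hs[i := a]) + deriv_at x (hs[i := b]) \<and>
      deriv_at x (hs[i := r *\<^sub>R a]) = r *\<^sub>R deriv_at x (hs[i := a])"
    if "x \<in> ?S" "i < length hs" for x :: 'a and hs i a b r
    using linear_deriv_at[OF that] linear_add linear_scale by blast
  have bdd: "\<exists>C. \<forall>x\<in>B. \<forall>hs. set hs \<subseteq> ?S \<longrightarrow> length hs = k \<longrightarrow> norm (deriv_at x hs) \<le> C * ?P hs"
    if B: "B \<subseteq> ?S" "bounded B" for k and B :: "'a set"
  proof -
    obtain R where R: "R > 0" "\<And>x. x \<in> B \<Longrightarrow> norm x \<le> R"
      using B(2) unfolding bounded_pos by blast
    obtain C where "\<forall>x\<in>?S. norm x \<le> R \<longrightarrow> (\<forall>hs. length hs = k \<longrightarrow> norm (deriv_at x hs) \<le> C * ?P hs)"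
      using deriv_at_bound[OF R(1)] by blast
    then show ?thesis using R(2) B(1) by blast
  qed
  have bdd1: "\<exists>C. \<forall>hs. set hs \<subseteq> ?S \<longrightarrow> length hs = k \<longrightarrow> norm (deriv_at x hs) \<le> C * ?P hs"
    if "x \<in> ?S" for k and x :: 'a
    using bdd[of "{x}" k] that by auto
  have der: "\<exists>\<delta>>0. \<forall>y\<in>?S. norm (y - x) < \<delta> \<longrightarrow> (\<forall>hs. set hs \<subseteq> ?S \<longrightarrow> length hs = k \<longrightarrow>
      norm (deriv_at y hs - deriv_at x hs - deriv_at x ((y - x) # hs)) \<le> \<epsilon> * norm (y - x) * ?P hs)"
    if x: "x \<in> ?S" and e: "\<epsilon> > 0" for k and x :: 'a and \<epsilon> :: real
  proof -
    obtain C where C: "C \<ge> 0" "\<And>y hs. y \<in> ?S \<Longrightarrow> norm y \<le> norm x + 1 \<Longrightarrow> length hs = k \<Longrightarrow>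
        norm (deriv_at y hs - deriv_at x hs - deriv_at x ((y - x) # hs)) \<le> C * (norm (y - x))\<^sup>2 * ?P hs"
      using deriv_at_taylor[OF pos[of x], where k = k and 'a = 'a] x by fastforce
    show ?thesis
    \<comment> \<open>The 1 keeps \<open>y\<close> in the ball of radius \<open>norm x + 1\<close>,
      for which \<open>C\<close> was chosen; the other bound makes one factor
      \<open>norm (y - x)\<close> absorb \<open>C\<close>.\<close>
    proof (intro exI[of _ "min 1 (\<epsilon> / (C + 1))"] conjI ballI impI allI)
      fix y :: 'a and hs :: "'a list" assume y: "y \<in> ?S" "norm (y - x) < min 1 (\<epsilon> / (C + 1))" and len: "length hs = k"
      have "norm (y - x) * (C + 1) \<le> \<epsilon>" using y(2) C(1) by (simp add: pos_less_divide_eq less_imp_le)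
      then have "C * norm (y - x) \<le> \<epsilon>"
        using norm_ge_zero[of "y - x"] by (simp only: distrib_left mult.commute[of C])
      then have "C * (norm (y - x))\<^sup>2 * ?P hs \<le> \<epsilon> * norm (y - x) * ?P hs"
        unfolding power2_eq_square mult.assoc[symmetric] by (intro mult_right_mono P0) auto
      then show "norm (deriv_at y hs - deriv_at x hs - deriv_at x ((y - x) # hs)) \<le> \<epsilon> * norm (y - x) * ?P hs"
        using C(2)[OF y(1) near len] y(2) by fastforce
    qed (use e C(1) in auto)
  qed
  \<comment> \<open>Continuity in operator norm follows from differentiability with tolerance 1 and
    the bound on the next derivative at \<open>x\<close>.\<close>
  have cont: "\<exists>\<delta>>0. \<forall>y\<in>?S. norm (y - x) < \<delta> \<longrightarrow> (\<forall>hs. set hs \<subseteq> ?S \<longrightarrow> length hs = k \<longrightarrow>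
      norm (deriv_at y hs - deriv_at x hs) \<le> \<epsilon> * ?P hs)"
    if x: "x \<in> ?S" and e: "\<epsilon> > 0" for k and x :: 'a and \<epsilon> :: real
  proof -
    obtain C where C: "C \<ge> 0" "\<And>hs. length hs = Suc k \<Longrightarrow> norm (deriv_at x hs) \<le> C * ?P hs"
      using deriv_at_bound[OF pos[of x], where k = "Suc k" and 'a = 'a] x by fastforce
    obtain d where d: "d > 0" "\<And>y hs. y \<in> ?S \<Longrightarrow> norm (y - x) < d \<Longrightarrow> set hs \<subseteq> ?S \<Longrightarrow> length hs = k \<Longrightarrow>
        norm (deriv_at y hs - deriv_at x hs - deriv_at x ((y - x) # hs)) \<le> 1 * norm (y - x) * ?P hs"
      using der[OF x, of 1 k] by fastforce
    show ?thesis
    proof (intro exI[of _ "min d (\<epsilon> / (C + 1))"] conjI ballI impI allI)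
      fix y :: 'a and hs :: "'a list"
      assume y: "y \<in> ?S" "norm (y - x) < min d (\<epsilon> / (C + 1))" and hs: "set hs \<subseteq> ?S" "length hs = k"
      have *: "norm (y - x) * (C + 1) \<le> \<epsilon>" using y(2) C(1) by (simp add: pos_less_divide_eq less_imp_le)
      have "norm (deriv_at y hs - deriv_at x hs) \<le>
          norm (deriv_at y hs - deriv_at x hs - deriv_at x ((y - x) # hs)) + norm (deriv_at x ((y - x) # hs))"
        by norm
      also have "\<dots> \<le> norm (y - x) * ?P hs + C * (norm (y - x) * ?P hs)"
        using d(2)[OF y(1) _ hs] y(2) C(2)[of "(y - x) # hs"] hs(2) by (intro add_mono) auto
      also have "\<dots> = (norm (y - x) * (C + 1)) * ?P hs" by (simp add: algebra_simps)
      also have "\<dots> \<le> \<epsilon> * ?P hs" by (intro mult_right_mono * P0)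
      finally show "norm (deriv_at y hs - deriv_at x hs) \<le> \<epsilon> * ?P hs" .
    qed (use e C(1) d(1) in auto)
  qed
  \<comment> \<open>The witness ignores its order argument, because the length of the list carries
    it.\<close>
  show ?thesis
    unfolding BC_infty_def
    by (intro exI[of _ "\<lambda>_ x hs. deriv_at x hs"] conjI allI ballI impI)
      (use D0 lin bdd bdd1 der cont in auto)
qed

end

theorem theorem4:
  fixes g :: "real \<Rightarrow> complex"
  assumes "smooth_real_fun g"
  shows "BC_infty (hermitian_elems :: 'a::cstar_algebra set) (\<lambda>x. cfc x g)"
proof -
  obtain G where chain: "G 0 = g" "\<And>k t. (G k has_vector_derivative G (Suc k) t) (at t)"
    using assms unfolding smooth_real_fun_def by blast
  obtain p where "\<And>n i t. i \<le> n \<Longrightarrow> \<bar>t\<bar> \<le> real n \<Longrightarrow>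
     cmod (poly ((pderiv ^^ i) (p n)) (of_real t) - G i t) \<le> inverse (real (Suc n))"
    using smooth_poly_sequence[of G] chain(2) by blast
  then interpret smooth_approximation G p
    by unfold_locales (use chain(2) in auto)
  show ?thesis using BC_infty_cfc unfolding chain(1) .
qed

end
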